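(* Let $J\in\{I,J_1,J_+\}$ and $\otimes\in\{\times,\boxdot\}$. Let $X$ be a closure space and let $A\subseteq X$ be a subspace. Then there exist long exact sequences $$\cdots\to H^J_n(A)\to H^J_n(X)\to H^J_n(X,A)\to H^J_{n-1}(A)\to\cdots$$ $$\cdots\to H^{(J,\otimes)}_n(A)\to H^{(J,\otimes)}_n(X)\to H^{(J,\otimes)}_n(X,A)\to H^{(J,\otimes)}_{n-1}(A)\to\cdots$$
   Context: A closure space $(X,c)$ is a set $X$ with a map $c:\mathcal P(X)\to\mathcal P(X)$ such that $c(\emptyset)=\emptyset$, $A\subseteq c(A)$, and $c(A\cup B)=c(A)\cup c(B)$. A subset $A\subseteq X$ carries the subspace closure $B\mapsto c(B)\cap A$. The interior is $i(A)=X\setminus c(X\setminus A)$, and $V$ is a neighborhood of $x$ if $x\in i(V)$. A map $f:(X,c)\to(Y,d)$ is continuous if $f(c(A))\subseteq d(f(A))$ for all $A\subseteq X$. Topological spaces are closure spaces via the topological closure. The product $X\times Y$ is the set product with the closure for which the sets $U\times V$ ($U$ a neighborhood of $x$, $V$ of $y$) form a neighborhood base at $(x,y)$; the inductive product $X\boxdot Y$ is the set product with the closure for which the sets $(\{x\}\times V)\cup(U\times\{y\})$ form a neighborhood base at $(x,y)$. Spaces: $I=[0,1]$ with the usual topology; $J_1=\{0,1\}$ with the indiscrete closure; $J_+=\{0,1\}$ with $c(\{0\})=\{0,1\}$, $c(\{1\})=\{1\}$. Singular simplices: $|\Delta^n|^{I}$ is the standard topological $n$-simplex; $|\Delta^n|^{J_1}$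 is $\{0,\dots,n\}$ with the indiscrete closure; $|\Delta^n|^{J_+}$ is $\{0,\dots,n\}$ with $c(\{i\})=\{j: j\ge i\}$. $C^J_n(X)$ is the free abelian group on continuous maps $\sigma:|\Delta^n|^J\to X$, with $\partial\sigma=\sum_{i=0}^n(-1)^i\sigma\circ d^i$, $d^i$ the $i$-th face inclusion; $H^J_n(X)$ is its homology. Singular cubes: $J^{\otimes n}$ is the $n$-fold $\otimes$-product (a point if $n=0$). Let $Q_n(X)$ be the free abelian group on continuous maps $\sigma:J^{\otimes n}\to X$ and $D_n(X)$ the subgroup generated by the degenerate $\sigma$, i.e. those that do not depend on their $i$-th coordinate for some $1\le i\le n$. Then $C^{(J,\otimes)}_n(X)=Q_n(X)/D_n(X)$, with $\partial\sigma=\sum_{i=1}^n(-1)^i(A_i\sigma-B_i\sigma)$, where $A_i\sigma$ (resp. $B_i\sigma$) is $\sigma$ with $0$ (resp. $1$) inserted in the $i$-th coordinate; $H^{(J,\otimes)}_n(X)$ is its homology. $H^J_n(X,A)$ and $H^{(J,\otimes)}_n(X,A)$ are the homology groups of the quotient complexes $C^J_\bullet(X)/C^J_\bullet(A)$ and $C^{(J,\otimes)}_\bullet(X)/C^{(J,\otimes)}_\bullet(A)$. In the sequences the maps $H_n(A)\to H_n(X)\to H_n(X,A)$ are induced by inclusion and quotient. *)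

theory Defs
  imports "HOL-Analysis.Analysis" "HOL-Homology.Simplices" "HOL-Algebra.Coset"
begin

section \<open>Closure spaces\<close>

text \<open>Only the values of \<open>cl\<close> on subsets of \<open>points\<close> matter.\<close>

record 'a cspace =
  points :: "'a set"
  cl :: "'a set \<Rightarrow> 'a set"

definition closure_space :: "'a cspace \<Rightarrow> bool" where
  "closure_space X \<longleftrightarrow>
     cl X {} = {} \<and>
     (\<forall>A. A \<subseteq> points X \<longrightarrow> A \<subseteq> cl X A \<and> cl X A \<subseteq> points X) \<and>
     (\<forall>A B. A \<subseteq> points X \<longrightarrow> B \<subseteq> points X \<longrightarrow> cl X (A \<union> B) = cl X A \<union> cl X B)"

definition subspace :: "'a cspace \<Rightarrow> 'a set \<Rightarrow> 'a cspace" where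
  "subspace X A = \<lparr>points = A, cl = (\<lambda>B. cl X B \<inter> A)\<rparr>"

definition cinterior :: "'a cspace \<Rightarrow> 'a set \<Rightarrow> 'a set" where
  "cinterior X A = points X - cl X (points X - A)"

definition neighborhoods :: "'a cspace \<Rightarrow> 'a \<Rightarrow> 'a set set" where
  "neighborhoods X x = {V. V \<subseteq> points X \<and> x \<in> cinterior X V}"

definition ccontinuous :: "'a cspace \<Rightarrow> 'b cspace \<Rightarrow> ('a \<Rightarrow> 'b) \<Rightarrow> bool" where
  "ccontinuous X Y f \<longleftrightarrow>
     f \<in> points X \<rightarrow> points Y \<and> (\<forall>A. A \<subseteq> points X \<longrightarrow> f ` cl X A \<subseteq> cl Y (f ` A))"

definition cspace_of_topology :: "'a topology \<Rightarrow> 'a cspace" where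
  "cspace_of_topology T = \<lparr>points = topspace T, cl = (\<lambda>B. T closure_of B)\<rparr>"

definition indiscrete :: "'a set \<Rightarrow> 'a cspace" where
  "indiscrete S = \<lparr>points = S, cl = (\<lambda>B. if B = {} then {} else S)\<rparr>"

text \<open>The closure with \<open>c({x}) = {y. y \<ge> x}\<close>, extended additively.\<close>

definition upward :: "'a::linorder set \<Rightarrow> 'a cspace" where
  "upward S = \<lparr>points = S, cl = (\<lambda>B. {y \<in> S. \<exists>x\<in>B. x \<le> y})\<rparr>"

text \<open>The closure determined by a neighborhood base: \<open>x\<close> lies in the closure of \<open>B\<close> iff the
  complement of \<open>B\<close> is not a neighborhood of \<open>x\<close>, i.e. iff every basic set at \<open>x\<close> meets \<open>B\<close>.\<close>

definition from_nbhd_base :: "'a set \<Rightarrow> ('a \<Rightarrow> 'a set set) \<Rightarrow> 'a cspace" where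
  "from_nbhd_base S \<B> = \<lparr>points = S, cl = (\<lambda>B. {x \<in> S. \<forall>N \<in> \<B> x. N \<inter> B \<noteq> {}})\<rparr>"

lemma neighborhoods_from_nbhd_base:
  assumes "x \<in> S" and "\<And>N. N \<in> \<B> x \<Longrightarrow> N \<subseteq> S"
  shows "neighborhoods (from_nbhd_base S \<B>) x = {V. V \<subseteq> S \<and> (\<exists>N \<in> \<B> x. N \<subseteq> V)}"
proof -
  have "N \<inter> (S - V) \<noteq> {} \<longleftrightarrow> \<not> N \<subseteq> V" if "N \<in> \<B> x" for N V
    using assms(2)[OF that] by blast
  then show ?thesis
    using assms(1) by (simp add: neighborhoods_def cinterior_def from_nbhd_base_def)
qed

definition cproduct :: "'a cspace \<Rightarrow> 'b cspace \<Rightarrow> ('a \<times> 'b) cspace" where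
  "cproduct X Y = from_nbhd_base (points X \<times> points Y)
     (\<lambda>(x, y). {U \<times> V | U V. U \<in> neighborhoods X x \<and> V \<in> neighborhoods Y y})"

definition inductive_product :: "'a cspace \<Rightarrow> 'b cspace \<Rightarrow> ('a \<times> 'b) cspace" where
  "inductive_product X Y = from_nbhd_base (points X \<times> points Y)
     (\<lambda>(x, y). {({x} \<times> V) \<union> (U \<times> {y}) | U V. U \<in> neighborhoods X x \<and> V \<in> neighborhoods Y y})"


section \<open>Chain complexes of abelian groups and their homology\<close>

text \<open>Complexes are indexed by the integers; \<open>bd C n\<close> maps degree \<open>n\<close> to degree \<open>n - 1\<close>.  Those
  constructed below are trivial in negative degrees.\<close>

record 'c chain_cx =
  grp :: "int \<Rightarrow> 'c monoid"
  bd :: "int \<Rightarrow> 'c \<Rightarrow> 'c"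

text \<open>The map \<open>G/N \<rightarrow> G'/N'\<close> of quotient groups induced by a homomorphism \<open>h : G \<rightarrow> G'\<close>
  with \<open>h(N) \<subseteq> N'\<close>, as a map of cosets.\<close>

definition quot_map :: "'d monoid \<Rightarrow> 'd set \<Rightarrow> ('c \<Rightarrow> 'd) \<Rightarrow> 'c set \<Rightarrow> 'd set" where
  "quot_map G' N' h U = (\<Union>x\<in>U. N' #>\<^bsub>G'\<^esub> h x)"

lemma quot_map_coset:
  assumes "group_hom G G' h" and N: "subgroup N G" and N': "subgroup N' G'"
    and hN: "h ` N \<subseteq> N'" and x: "x \<in> carrier G"
  shows "quot_map G' N' h (N #>\<^bsub>G\<^esub> x) = N' #>\<^bsub>G'\<^esub> h x"
proof -
  interpret group_hom G G' h by fact
  have "N' #>\<^bsub>G'\<^esub> h y = N' #>\<^bsub>G'\<^esub> h x" if y: "y \<in> N #>\<^bsub>G\<^esub> x" for y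
  proof -
    obtain a where a: "a \<in> N" "y = a \<otimes>\<^bsub>G\<^esub> x"
      using y by (auto simp: r_coset_def)
    then have "a \<in> carrier G" "h a \<in> N'"
      using N hN subgroup.mem_carrier by fastforce+
    then have "h y = h a \<otimes>\<^bsub>G'\<^esub> h x"
      using a x by simp
    then have "h y \<in> N' #>\<^bsub>G'\<^esub> h x"
      using \<open>h a \<in> N'\<close> by (auto simp: r_coset_def)
    then show ?thesis
      using H.repr_independence[OF _ _ N'] x by auto
  qed
  moreover have "x \<in> N #>\<^bsub>G\<^esub> x"
    using G.rcos_self[OF x N] .
  ultimately show ?thesis
    unfolding quot_map_def by blast
qed

definition quotient_cx :: "'c chain_cx \<Rightarrow> (int \<Rightarrow> 'c set) \<Rightarrow> 'c set chain_cx" where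
  "quotient_cx C N =
     \<lparr>grp = (\<lambda>n. grp C n Mod N n),
      bd = (\<lambda>n. quot_map (grp C (n - 1)) (N (n - 1)) (bd C n))\<rparr>"

definition cycles :: "'c chain_cx \<Rightarrow> int \<Rightarrow> 'c set" where
  "cycles C n = kernel (grp C n) (grp C (n - 1)) (bd C n)"

definition boundaries :: "'c chain_cx \<Rightarrow> int \<Rightarrow> 'c set" where
  "boundaries C n = bd C (n + 1) ` carrier (grp C (n + 1))"

definition homology :: "'c chain_cx \<Rightarrow> int \<Rightarrow> 'c set monoid" where
  "homology C n = (grp C n\<lparr>carrier := cycles C n\<rparr>) Mod boundaries C n"

definition homology_map :: "'d chain_cx \<Rightarrow> (int \<Rightarrow> 'c \<Rightarrow> 'd) \<Rightarrow> int \<Rightarrow> 'c set \<Rightarrow> 'd set" where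
  "homology_map D f n = quot_map (grp D n) (boundaries D n) (f n)"

definition exact_at ::
    "'a monoid \<Rightarrow> ('a \<Rightarrow> 'b) \<Rightarrow> 'b monoid \<Rightarrow> ('b \<Rightarrow> 'c) \<Rightarrow> 'c monoid \<Rightarrow> bool" where
  "exact_at G f H g K \<longleftrightarrow>
     group_hom G H f \<and> group_hom H K g \<and> f ` carrier G = kernel H K g"

text \<open>For a chain map \<open>\<iota> : K \<rightarrow> L\<close>, the quotient complex \<open>L/K\<close> is \<open>L\<close> modulo the image of
  \<open>K\<close>.  The predicate says that there are connecting homomorphisms
  \<open>\<delta>\<^sub>n : H\<^sub>n(L/K) \<rightarrow> H\<^sub>n\<^sub>-\<^sub>1(K)\<close> which make the long sequence exact everywhere.\<close>

definition relative_cx :: "'c chain_cx \<Rightarrow> 'd chain_cx \<Rightarrow> (int \<Rightarrow> 'c \<Rightarrow> 'd) \<Rightarrow> 'd set chain_cx" where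
  "relative_cx K L \<iota> = quotient_cx L (\<lambda>n. \<iota> n ` carrier (grp K n))"

definition relative_proj ::
    "'c chain_cx \<Rightarrow> 'd chain_cx \<Rightarrow> (int \<Rightarrow> 'c \<Rightarrow> 'd) \<Rightarrow> int \<Rightarrow> 'd \<Rightarrow> 'd set" where
  "relative_proj K L \<iota> n x = (\<iota> n ` carrier (grp K n)) #>\<^bsub>grp L n\<^esub> x"

definition long_exact_sequence ::
    "'c chain_cx \<Rightarrow> 'd chain_cx \<Rightarrow> (int \<Rightarrow> 'c \<Rightarrow> 'd) \<Rightarrow> bool" where
  "long_exact_sequence K L \<iota> \<longleftrightarrow>
    (let M = relative_cx K L \<iota>;
         i = homology_map L \<iota>;
         p = homology_map M (relative_proj K L \<iota>)
     in \<exists>\<delta>. \<forall>n.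
          exact_at (homology K n) (i n) (homology L n) (p n) (homology M n) \<and>
          exact_at (homology L n) (p n) (homology M n) (\<delta> n) (homology K (n - 1)) \<and>
          exact_at (homology M n) (\<delta> n) (homology K (n - 1)) (i (n - 1)) (homology L (n - 1)))"


section \<open>Singular simplices\<close>

text \<open>A family \<open>\<Delta>\<close> of model simplices with face inclusions \<open>d i : \<Delta> (n - 1) \<rightarrow> \<Delta> n\<close>
  (given by the same formula for all \<open>n\<close>).  Maps out of \<open>\<Delta> n\<close> are represented by functions
  that are \<open>undefined\<close> off \<open>points (\<Delta> n)\<close>, so that distinct maps are distinct generators.\<close>

definition singular_simplices :: "(nat \<Rightarrow> 'p cspace) \<Rightarrow> nat \<Rightarrow> 'a cspace \<Rightarrow> ('p \<Rightarrow> 'a) set" where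
  "singular_simplices \<Delta> n X =
     {\<sigma> \<in> extensional (points (\<Delta> n)). ccontinuous (\<Delta> n) X \<sigma>}"

definition singular_cx ::
    "(nat \<Rightarrow> 'p cspace) \<Rightarrow> (nat \<Rightarrow> 'p \<Rightarrow> 'p) \<Rightarrow> 'a cspace \<Rightarrow> (('p \<Rightarrow> 'a) \<Rightarrow>\<^sub>0 int) chain_cx" where
  "singular_cx \<Delta> d X =
     \<lparr>grp = (\<lambda>n. free_Abelian_group (if n < 0 then {} else singular_simplices \<Delta> (nat n) X)),
      bd = (\<lambda>n. if n \<le> 0 then (\<lambda>_. 0)
                else frag_extend (\<lambda>\<sigma>. \<Sum>i\<le>nat n. frag_cmul ((-1) ^ i)
                       (frag_of (restrict (\<sigma> \<circ> d i) (points (\<Delta> (nat n - 1)))))))\<rparr>"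

text \<open>A simplex of a subspace \<open>A\<close> is literally a simplex of \<open>X\<close>, so the chain map induced by
  the inclusion is the identity on representatives.\<close>

definition singular_LES ::
    "(nat \<Rightarrow> 'p cspace) \<Rightarrow> (nat \<Rightarrow> 'p \<Rightarrow> 'p) \<Rightarrow> 'a cspace \<Rightarrow> 'a set \<Rightarrow> bool" where
  "singular_LES \<Delta> d X A \<longleftrightarrow>
     long_exact_sequence (singular_cx \<Delta> d (subspace X A)) (singular_cx \<Delta> d X) (\<lambda>n c. c)"

definition simplex_I :: "nat \<Rightarrow> (nat \<Rightarrow> real) cspace" where
  "simplex_I n = cspace_of_topology (subtopology (powertop_real UNIV) (standard_simplex n))"

definition simplex_J1 :: "nat \<Rightarrow> nat cspace" where
  "simplex_J1 n = indiscrete {0..n}"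

definition simplex_Jplus :: "nat \<Rightarrow> nat cspace" where
  "simplex_Jplus n = upward {0..n}"

definition vertex_face :: "nat \<Rightarrow> nat \<Rightarrow> nat" where
  "vertex_face i k = (if k < i then k else k + 1)"


section \<open>Singular cubes\<close>

definition interval_I :: "real cspace" where
  "interval_I = cspace_of_topology (top_of_set {0..1})"

definition interval_J1 :: "real cspace" where
  "interval_J1 = indiscrete {0, 1}"

definition interval_Jplus :: "real cspace" where
  "interval_Jplus = upward {0, 1}"

text \<open>Transport of structure along a function that is injective on the points.\<close>

definition relabel :: "('a \<Rightarrow> 'b) \<Rightarrow> 'a cspace \<Rightarrow> 'b cspace" where
  "relabel f X = \<lparr>points = f ` points X, cl = (\<lambda>B. f ` cl X {x \<in> points X. f x \<in> B})\<rparr>"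

text \<open>The \<open>n\<close>-fold product \<open>J \<otimes> (J \<otimes> (\<dots> \<otimes> point))\<close>, with nested pairs
  written as lists of length \<open>n\<close>.\<close>

type_synonym cube_product = "real cspace \<Rightarrow> real list cspace \<Rightarrow> (real \<times> real list) cspace"

primrec cube :: "cube_product \<Rightarrow> real cspace \<Rightarrow> nat \<Rightarrow> real list cspace" where
  "cube T J 0 = indiscrete {[]}"
| "cube T J (Suc n) = relabel (\<lambda>(t, ts). t # ts) (T J (cube T J n))"

definition singular_cubes ::
    "cube_product \<Rightarrow> real cspace \<Rightarrow> nat \<Rightarrow> 'a cspace \<Rightarrow> (real list \<Rightarrow> 'a) set" where
  "singular_cubes T J n X =
     {\<sigma> \<in> extensional (points (cube T J n)). ccontinuous (cube T J n) X \<sigma>}"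

text \<open>List positions count from \<open>0\<close>: coordinate \<open>i\<close> of the mathematical text is \<open>! (i - 1)\<close>.\<close>

definition degenerate_cubes ::
    "cube_product \<Rightarrow> real cspace \<Rightarrow> nat \<Rightarrow> 'a cspace \<Rightarrow> (real list \<Rightarrow> 'a) set" where
  "degenerate_cubes T J n X =
     {\<sigma> \<in> singular_cubes T J n X.
        \<exists>i\<in>{1..n}. \<forall>ts \<in> points (cube T J n). \<forall>t \<in> points J. \<sigma> (ts[i - 1 := t]) = \<sigma> ts}"

definition cube_face ::
    "cube_product \<Rightarrow> real cspace \<Rightarrow> nat \<Rightarrow> real \<Rightarrow> nat \<Rightarrow> (real list \<Rightarrow> 'a) \<Rightarrow> real list \<Rightarrow> 'a" where
  "cube_face T J n e i \<sigma> =
     restrict (\<lambda>ts. \<sigma> (take (i - 1) ts @ e # drop (i - 1) ts)) (points (cube T J (n - 1)))"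

definition all_cubes_cx ::
    "cube_product \<Rightarrow> real cspace \<Rightarrow> 'a cspace \<Rightarrow> ((real list \<Rightarrow> 'a) \<Rightarrow>\<^sub>0 int) chain_cx" where
  "all_cubes_cx T J X =
     \<lparr>grp = (\<lambda>n. free_Abelian_group (if n < 0 then {} else singular_cubes T J (nat n) X)),
      bd = (\<lambda>n. if n \<le> 0 then (\<lambda>_. 0)
                else frag_extend (\<lambda>\<sigma>. \<Sum>i=1..nat n. frag_cmul ((-1) ^ i)
                       (frag_of (cube_face T J (nat n) 0 i \<sigma>) - frag_of (cube_face T J (nat n) 1 i \<sigma>))))\<rparr>"

definition degenerate_chains ::
    "cube_product \<Rightarrow> real cspace \<Rightarrow> 'a cspace \<Rightarrow> int \<Rightarrow> ((real list \<Rightarrow> 'a) \<Rightarrow>\<^sub>0 int) set" where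
  "degenerate_chains T J X n =
     generate (grp (all_cubes_cx T J X) n)
       (frag_of ` (if n < 0 then {} else degenerate_cubes T J (nat n) X))"

definition cubical_cx ::
    "cube_product \<Rightarrow> real cspace \<Rightarrow> 'a cspace \<Rightarrow> ((real list \<Rightarrow> 'a) \<Rightarrow>\<^sub>0 int) set chain_cx" where
  "cubical_cx T J X = quotient_cx (all_cubes_cx T J X) (degenerate_chains T J X)"

definition cubical_inclusion ::
    "cube_product \<Rightarrow> real cspace \<Rightarrow> 'a cspace \<Rightarrow>
     int \<Rightarrow> ((real list \<Rightarrow> 'a) \<Rightarrow>\<^sub>0 int) set \<Rightarrow> ((real list \<Rightarrow> 'a) \<Rightarrow>\<^sub>0 int) set" where
  "cubical_inclusion T J X n =
     quot_map (grp (all_cubes_cx T J X) n) (degenerate_chains T J X n) (\<lambda>c. c)"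

definition cubical_LES :: "cube_product \<Rightarrow> real cspace \<Rightarrow> 'a cspace \<Rightarrow> 'a set \<Rightarrow> bool" where
  "cubical_LES T J X A \<longleftrightarrow>
     long_exact_sequence (cubical_cx T J (subspace X A)) (cubical_cx T J X) (cubical_inclusion T J X)"

end

theory Submission
  imports Defs
begin

text \<open>A subspace inclusion induces an injective chain map: a simplex or cube in \<open>A\<close> is one in \<open>X\<close>,
  and a cube in \<open>A\<close> that is degenerate in \<open>X\<close> is degenerate in \<open>A\<close>, since degeneracy only refers to
  the values of the cube.  Hence the sequences come from the snake lemma; what remains is that
  the chain groups are complexes.  For cubes this rests on the continuity of the insertion of a
  coordinate, which is built from the slices \<open>y \<mapsto> (e, y)\<close> and the maps \<open>(t, y) \<mapsto> (t, f y)\<close>,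
  continuous for both products.\<close>

section \<open>The long exact sequence of an injective chain map\<close>

text \<open>The relative complex is by definition the quotient by the image of the chain map, so the
  short sequence is exact as soon as that map is injective, and one statement on complexes serves
  simplices and cubes alike. For cubes the chain groups are themselves quotients Q/D, and
  injectivity there is not inherited from Q: it amounts to D(A) = D(X) \<inter> Q(A). As chains are
  finitely supported functions, this becomes a statement about supports, checked generator by
  generator. The obstacle on the cubical side is that cubes are right-nested products written as
  lists: a coordinate inserted behind the leading factors can be reached only through the second
  argument of each product, so the insertion is built by recursion through the factors. Both
  products admit this argument because it depends on their basic sets only through four
  inclusions.\<close>

lemma (in group) rcos_eq_iff:
  assumes "subgroup N G" "x \<in> carrier G" "y \<in> carrier G"
  shows "N #> x = N #> y \<longleftrightarrow> x \<otimes> inv y \<in> N"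
proof -
  interpret subgroup N G by fact
  show ?thesis
    using rcos_module[OF is_group assms(3,2)] repr_independence[OF _ assms(3,1)] rcos_self[OF assms(2,1)]
    by auto
qed

section \<open>Chain complexes and homology classes of chains\<close>

locale chain_complex =
  fixes C :: "'c chain_cx"
  assumes comm_grp: "comm_group (grp C n)"
    and bd_hom: "bd C n \<in> hom (grp C n) (grp C (n - 1))"
    and bd_bd: "x \<in> carrier (grp C n) \<Longrightarrow> bd C (n - 1) (bd C n x) = \<one>\<^bsub>grp C (n - 1 - 1)\<^esub>"
begin

sublocale G: comm_group "grp C n" for n
  by (rule comm_grp)

sublocale D: group_hom "grp C n" "grp C (n - 1)" "bd C n" for n
  by unfold_locales (rule bd_hom)

text \<open>\<open>boundaries\<close> starts in degree \<open>n + 1\<close>, while the locale facts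
  end in degree \<open>n - 1\<close>. This rule and the next carry the normalised form of
  \<open>n + 1 - 1\<close>, on which the simplifier can work.\<close>

lemma bd_Suc_closed [simp]: "x \<in> carrier (grp C (n + 1)) \<Longrightarrow> bd C (n + 1) x \<in> carrier (grp C n)"
  using D.hom_closed[of x "n + 1"] by simp

lemma bd_bd_Suc [simp]:
  "x \<in> carrier (grp C (n + 1)) \<Longrightarrow> bd C n (bd C (n + 1) x) = \<one>\<^bsub>grp C (n - 1)\<^esub>"
  using bd_bd[of x "n + 1"] by simp

lemma mem_cycles_iff: "x \<in> cycles C n \<longleftrightarrow> x \<in> carrier (grp C n) \<and> bd C n x = \<one>\<^bsub>grp C (n - 1)\<^esub>"
  by (simp add: cycles_def kernel_def)

lemma subgroup_cycles: "subgroup (cycles C n) (grp C n)"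
  unfolding cycles_def by (rule D.subgroup_kernel)

lemma subgroup_boundaries: "subgroup (boundaries C n) (grp C n)"
  using group_hom.img_is_subgroup[OF D.group_hom_axioms[of "n + 1"]]
  by (simp add: boundaries_def)

lemma bd_in_boundaries: "x \<in> carrier (grp C n) \<Longrightarrow> bd C n x \<in> boundaries C (n - 1)"
  by (simp add: boundaries_def)

lemma boundaries_subset_cycles: "boundaries C n \<subseteq> cycles C n"
  by (auto simp: boundaries_def mem_cycles_iff)

text \<open>The coset is taken in the full chain group, whereas \<open>homology\<close> divides the
  group of cycles. Cosets refer only to the multiplication, so the two agree; this form matches
  \<open>homology_map\<close>, which also uses the full group.\<close>

definition hclass :: "int \<Rightarrow> 'c \<Rightarrow> 'c set" where
  "hclass n z = boundaries C n #>\<^bsub>grp C n\<^esub> z"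

lemma comm_group_cycles: "comm_group (grp C n\<lparr>carrier := cycles C n\<rparr>)"
proof -
  interpret subgroup "cycles C n" "grp C n" by (rule subgroup_cycles)
  show ?thesis
    by (rule group.group_comm_groupI[OF subgroup_is_group[OF G.is_group]])
       (simp add: G.m_comm)
qed

lemma subgroup_boundaries_cycles: "subgroup (boundaries C n) (grp C n\<lparr>carrier := cycles C n\<rparr>)"
  by (rule G.subgroup_incl[OF subgroup_boundaries subgroup_cycles boundaries_subset_cycles])

lemma comm_group_homology: "comm_group (homology C n)"
  unfolding homology_def
  by (rule comm_group.abelian_FactGroup[OF comm_group_cycles subgroup_boundaries_cycles])

lemma carrier_homology: "carrier (homology C n) = hclass n ` cycles C n"
  by (simp add: homology_def carrier_FactGroup hclass_def r_coset_def)

lemma one_homology: "\<one>\<^bsub>homology C n\<^esub> = boundaries C n"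
  by (simp add: homology_def)

lemma hclass_mult:
  assumes "x \<in> cycles C n" "y \<in> cycles C n"
  shows "hclass n x \<otimes>\<^bsub>homology C n\<^esub> hclass n y = hclass n (x \<otimes>\<^bsub>grp C n\<^esub> y)"
proof -
  \<comment> \<open>Set multiplication does not see the carrier either, so normality in the full
    chain group suffices.\<close>
  have "normal (boundaries C n) (grp C n)"
    by (simp add: G.normal_iff_subgroup subgroup_boundaries)
  from normal.rcos_sum[OF this, of x y] show ?thesis
    using assms by (simp add: homology_def hclass_def set_mult_def mem_cycles_iff)
qed

lemma hclass_eq_iff:
  assumes "x \<in> carrier (grp C n)" "y \<in> carrier (grp C n)"
  shows "hclass n x = hclass n y \<longleftrightarrow> x \<otimes>\<^bsub>grp C n\<^esub> inv\<^bsub>grp C n\<^esub> y \<in> boundaries C n"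
  unfolding hclass_def by (rule G.rcos_eq_iff[OF subgroup_boundaries assms])

lemma hclass_eq_one_iff:
  assumes "x \<in> carrier (grp C n)"
  shows "hclass n x = \<one>\<^bsub>homology C n\<^esub> \<longleftrightarrow> x \<in> boundaries C n"
  using G.coset_join1[OF _ assms subgroup_boundaries] G.coset_join2[OF assms subgroup_boundaries]
  by (auto simp: hclass_def one_homology)

end

section \<open>Chain maps and the induced maps in homology\<close>

locale chain_map = C: chain_complex C + D: chain_complex D
  for C :: "'c chain_cx" and D :: "'d chain_cx" +
  fixes f :: "int \<Rightarrow> 'c \<Rightarrow> 'd"
  assumes map_hom: "f n \<in> hom (grp C n) (grp D n)"
    and map_bd: "x \<in> carrier (grp C n) \<Longrightarrow> f (n - 1) (bd C n x) = bd D n (f n x)"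
begin

sublocale F: group_hom "grp C n" "grp D n" "f n" for n
  by unfold_locales (rule map_hom)

lemma map_cycles: "z \<in> cycles C n \<Longrightarrow> f n z \<in> cycles D n"
  using map_bd[of z n] by (auto simp: C.mem_cycles_iff D.mem_cycles_iff)

lemma map_boundaries: "z \<in> boundaries C n \<Longrightarrow> f n z \<in> boundaries D n"
  using map_bd[of _ "n + 1"] by (auto simp: boundaries_def)

lemma homology_map_hclass:
  assumes "z \<in> carrier (grp C n)"
  shows "homology_map D f n (C.hclass n z) = D.hclass n (f n z)"
  unfolding homology_map_def C.hclass_def D.hclass_def
  by (rule quot_map_coset[OF F.group_hom_axioms C.subgroup_boundaries D.subgroup_boundaries _ assms])
     (auto intro: map_boundaries)

lemma group_hom_homology_map: "group_hom (homology C n) (homology D n) (homology_map D f n)"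
proof -
  have "homology_map D f n \<in> hom (homology C n) (homology D n)"
  proof (rule homI)
    fix U assume "U \<in> carrier (homology C n)"
    then show "homology_map D f n U \<in> carrier (homology D n)"
      by (auto simp: C.carrier_homology D.carrier_homology C.mem_cycles_iff homology_map_hclass
          dest: map_cycles)
  next
    fix U V assume "U \<in> carrier (homology C n)" "V \<in> carrier (homology C n)"
    then obtain x y where xy: "x \<in> cycles C n" "y \<in> cycles C n" "U = C.hclass n x" "V = C.hclass n y"
      by (auto simp: C.carrier_homology)
    then have car: "x \<in> carrier (grp C n)" "y \<in> carrier (grp C n)"
      by (auto simp: C.mem_cycles_iff)
    show "homology_map D f n (U \<otimes>\<^bsub>homology C n\<^esub> V) =
        homology_map D f n U \<otimes>\<^bsub>homology D n\<^esub> homology_map D f n V"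
      using xy car by (simp add: C.hclass_mult homology_map_hclass D.hclass_mult map_cycles)
  qed
  then show ?thesis
    using C.comm_group_homology D.comm_group_homology
    by (simp add: group_hom_def group_hom_axioms_def comm_group_def)
qed

text \<open>Kernels and images are written as sets of classes of explicit representatives, so that
  exactness turns into a comparison of representatives.\<close>

lemma kernel_homology_map:
  "kernel (homology C n) (homology D n) (homology_map D f n) =
     C.hclass n ` {z \<in> cycles C n. f n z \<in> boundaries D n}"
proof -
  have "homology_map D f n (C.hclass n z) = \<one>\<^bsub>homology D n\<^esub> \<longleftrightarrow> f n z \<in> boundaries D n"
    if "z \<in> cycles C n" for z
    using that by (simp add: C.mem_cycles_iff homology_map_hclass D.hclass_eq_one_iff)
  then show ?thesis
    unfolding kernel_def C.carrier_homology by blast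
qed

lemma image_homology_map:
  "homology_map D f n ` carrier (homology C n) = D.hclass n ` f n ` cycles C n"
  by (force simp: C.carrier_homology C.mem_cycles_iff homology_map_hclass image_iff)

end

section \<open>The snake lemma for a short exact sequence of complexes\<close>

locale short_exact_sequence = I: chain_map K L i + P: chain_map L M p
  for K :: "'c chain_cx" and L :: "'d chain_cx" and M :: "'e chain_cx" and i p +
  assumes inj: "inj_on (i n) (carrier (grp K n))"
    and surj: "p n ` carrier (grp L n) = carrier (grp M n)"
    and exact: "i n ` carrier (grp K n) = kernel (grp L n) (grp M n) (p n)"
begin

notation I.C.hclass (\<open>hK\<close>) and I.D.hclass (\<open>hL\<close>) and P.D.hclass (\<open>hM\<close>)

lemma p_i: "k \<in> carrier (grp K n) \<Longrightarrow> p n (i n k) = \<one>\<^bsub>grp M n\<^esub>"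
  using exact[of n] by (auto simp: kernel_def)

lemma p_eq_one:
  assumes "y \<in> carrier (grp L n)" "p n y = \<one>\<^bsub>grp M n\<^esub>"
  obtains k where "k \<in> carrier (grp K n)" "y = i n k"
  using assms exact[of n] by (auto simp: kernel_def)

lemma i_eq_iff:
  "\<lbrakk>k \<in> carrier (grp K n); k' \<in> carrier (grp K n)\<rbrakk> \<Longrightarrow> i n k = i n k' \<longleftrightarrow> k = k'"
  using inj[of n] by (auto dest: inj_onD)

lemma i_eq_one_iff: "k \<in> carrier (grp K n) \<Longrightarrow> i n k = \<one>\<^bsub>grp L n\<^esub> \<longleftrightarrow> k = \<one>\<^bsub>grp K n\<^esub>"
  using i_eq_iff[of k n "\<one>\<^bsub>grp K n\<^esub>"] by simp

text \<open>\<open>y\<close> lifts a relative cycle and its boundary comes from \<open>w\<close>, as in the snake lemma.\<close>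

definition lifts :: "int \<Rightarrow> 'd \<Rightarrow> 'c \<Rightarrow> bool" where
  "lifts n y w \<longleftrightarrow> y \<in> carrier (grp L n) \<and> w \<in> carrier (grp K (n - 1)) \<and> i (n - 1) w = bd L n y"

text \<open>The boundary of \<open>p n y\<close> is the \<open>p\<close>-image of an element coming
  from \<open>K\<close>, hence trivial. Applying \<open>i\<close> to the boundary of
  \<open>w\<close> gives the double boundary of \<open>y\<close>, and injectivity of
  \<open>i\<close> does the rest.\<close>

lemma lifts_cycles:
  assumes "lifts n y w"
  shows "p n y \<in> cycles M n" "w \<in> cycles K (n - 1)"
proof -
  have y: "y \<in> carrier (grp L n)" and w: "w \<in> carrier (grp K (n - 1))" and e: "i (n - 1) w = bd L n y"
    using assms by (auto simp: lifts_def)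
  have "bd M n (p n y) = p (n - 1) (i (n - 1) w)"
    using P.map_bd[OF y] e by simp
  then show "p n y \<in> cycles M n"
    using y w by (simp add: P.D.mem_cycles_iff p_i)
  have "i (n - 1 - 1) (bd K (n - 1) w) = \<one>\<^bsub>grp L (n - 1 - 1)\<^esub>"
    using I.map_bd[OF w] e I.D.bd_bd[OF y] by simp
  then have "bd K (n - 1) w = \<one>\<^bsub>grp K (n - 1 - 1)\<^esub>"
    using i_eq_one_iff[OF I.C.D.hom_closed[OF w]] by blast
  then show "w \<in> cycles K (n - 1)"
    using w by (simp add: I.C.mem_cycles_iff)
qed

lemma lifts_ex:
  assumes "z \<in> cycles M n"
  obtains y w where "lifts n y w" "p n y = z"
proof -
  have z: "z \<in> carrier (grp M n)" "bd M n z = \<one>\<^bsub>grp M (n - 1)\<^esub>"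
    using assms by (auto simp: P.D.mem_cycles_iff)
  then obtain y where y: "y \<in> carrier (grp L n)" "p n y = z"
    using surj[of n] by (metis imageE)
  then have "p (n - 1) (bd L n y) = \<one>\<^bsub>grp M (n - 1)\<^esub>"
    using z P.map_bd[OF y(1)] by simp
  then obtain w where "w \<in> carrier (grp K (n - 1))" "bd L n y = i (n - 1) w"
    using p_eq_one[OF I.D.D.hom_closed[OF y(1)]] by blast
  then show ?thesis
    using that[of y w] y by (simp add: lifts_def)
qed

lemma lifts_mult:
  assumes "lifts n y w" "lifts n y' w'"
  shows "lifts n (y \<otimes>\<^bsub>grp L n\<^esub> y') (w \<otimes>\<^bsub>grp K (n - 1)\<^esub> w')"
  using assms by (simp add: lifts_def)

lemma lifts_div:
  assumes "lifts n y w" "lifts n y' w'"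
  shows "lifts n (y \<otimes>\<^bsub>grp L n\<^esub> inv\<^bsub>grp L n\<^esub> y') (w \<otimes>\<^bsub>grp K (n - 1)\<^esub> inv\<^bsub>grp K (n - 1)\<^esub> w')"
  using assms by (simp add: lifts_def)

text \<open>Surjectivity of \<open>p\<close> lifts the bounding chain to \<open>l\<close>; dividing
  \<open>y\<close> by the boundary of \<open>l\<close> leaves an element of the kernel of
  \<open>p\<close>, which comes from \<open>K\<close>. Both the independence of the connecting map
  from the lift and exactness at \<open>L\<close> rest on this decomposition.\<close>

lemma p_in_boundaries:
  assumes "y \<in> carrier (grp L n)" "p n y \<in> boundaries M n"
  obtains k l where "k \<in> carrier (grp K n)" "l \<in> carrier (grp L (n + 1))"
    "y = i n k \<otimes>\<^bsub>grp L n\<^esub> bd L (n + 1) l"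
proof -
  obtain l where l: "l \<in> carrier (grp L (n + 1))" "p n y = bd M (n + 1) (p (n + 1) l)"
    using assms(2) surj[of "n + 1"] unfolding boundaries_def by (metis imageE)
  let ?b = "bd L (n + 1) l"
  have b: "?b \<in> carrier (grp L n)" "p n ?b = p n y"
    using l P.map_bd[OF l(1)] by auto
  have "p n (y \<otimes>\<^bsub>grp L n\<^esub> inv\<^bsub>grp L n\<^esub> ?b) = \<one>\<^bsub>grp M n\<^esub>"
    using b assms(1) by simp
  then obtain k where k: "k \<in> carrier (grp K n)" "y \<otimes>\<^bsub>grp L n\<^esub> inv\<^bsub>grp L n\<^esub> ?b = i n k"
    using p_eq_one[of "y \<otimes>\<^bsub>grp L n\<^esub> inv\<^bsub>grp L n\<^esub> ?b" n] b assms(1) by auto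
  have "y = i n k \<otimes>\<^bsub>grp L n\<^esub> ?b"
    using b assms(1) by (simp add: k(2)[symmetric] I.D.G.m_assoc)
  then show ?thesis
    using that k(1) l(1) by blast
qed

text \<open>In the decomposition of \<open>y\<close> the part \<open>bd L (n + 1) l\<close> has
  trivial boundary, so \<open>w\<close> and \<open>bd K n k\<close> have the same image under the
  injective \<open>i\<close>.\<close>

lemma lifts_boundary:
  assumes "lifts n y w" "p n y \<in> boundaries M n"
  shows "w \<in> boundaries K (n - 1)"
proof -
  have y: "y \<in> carrier (grp L n)" and w: "w \<in> carrier (grp K (n - 1))" and e: "i (n - 1) w = bd L n y"
    using assms by (auto simp: lifts_def)
  obtain k l where k: "k \<in> carrier (grp K n)" and l: "l \<in> carrier (grp L (n + 1))"
    and yk: "y = i n k \<otimes>\<^bsub>grp L n\<^esub> bd L (n + 1) l"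
    using p_in_boundaries[OF y assms(2)] .
  have "i (n - 1) w = i (n - 1) (bd K n k)"
    using k l by (simp add: e yk I.map_bd)
  then have "w = bd K n k"
    using i_eq_iff[OF w I.C.D.hom_closed[OF k]] by blast
  then show ?thesis
    using k by (simp add: I.C.bd_in_boundaries)
qed

text \<open>Describing the value, instead of choosing a lift, turns independence of the lift into
  the uniqueness part of \<open>THE\<close>. On a class of \<open>M\<close>, existence is
  \<open>lifts_ex\<close> and uniqueness is \<open>lifts_unique\<close>.\<close>

definition connecting :: "int \<Rightarrow> 'e set \<Rightarrow> 'c set" where
  "connecting n U = (THE c. \<exists>y w. lifts n y w \<and> U = hM n (p n y) \<and> c = hK (n - 1) w)"

lemma lifts_unique:
  assumes "lifts n y w" "lifts n y' w'" "hM n (p n y) = hM n (p n y')"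
  shows "hK (n - 1) w = hK (n - 1) w'"
proof -
  have "y \<in> carrier (grp L n)" "y' \<in> carrier (grp L n)"
    and w: "w \<in> carrier (grp K (n - 1))" "w' \<in> carrier (grp K (n - 1))"
    using assms by (auto simp: lifts_def)
  then have "p n (y \<otimes>\<^bsub>grp L n\<^esub> inv\<^bsub>grp L n\<^esub> y') \<in> boundaries M n"
    using assms(3) by (simp add: P.D.hclass_eq_iff)
  from lifts_boundary[OF lifts_div[OF assms(1,2)] this] show ?thesis
    using w by (simp add: I.C.hclass_eq_iff)
qed

lemma connecting_lifts:
  assumes "lifts n y w"
  shows "connecting n (hM n (p n y)) = hK (n - 1) w"
  unfolding connecting_def
  using assms lifts_unique by (intro the_equality) blast+

lemma homology_lifts:
  assumes "U \<in> carrier (homology M n)"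
  obtains y w where "lifts n y w" "U = hM n (p n y)"
  using assms unfolding P.D.carrier_homology by (metis imageE lifts_ex)

lemma group_hom_connecting: "group_hom (homology M n) (homology K (n - 1)) (connecting n)"
proof -
  have "connecting n \<in> hom (homology M n) (homology K (n - 1))"
  proof (rule homI)
    fix U assume "U \<in> carrier (homology M n)"
    then obtain y w where "lifts n y w" "U = hM n (p n y)"
      by (rule homology_lifts)
    then show "connecting n U \<in> carrier (homology K (n - 1))"
      using lifts_cycles(2) by (auto simp: connecting_lifts I.C.carrier_homology)
  next
    fix U V assume "U \<in> carrier (homology M n)" "V \<in> carrier (homology M n)"
    then obtain y w y' w' where U: "lifts n y w" "U = hM n (p n y)" and V: "lifts n y' w'" "V = hM n (p n y')"
      by (metis homology_lifts)
    then have car: "y \<in> carrier (grp L n)" "y' \<in> carrier (grp L n)"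
      by (auto simp: lifts_def)
    have "U \<otimes>\<^bsub>homology M n\<^esub> V = hM n (p n (y \<otimes>\<^bsub>grp L n\<^esub> y'))"
      using U V car lifts_cycles(1) by (simp add: P.D.hclass_mult)
    then have "connecting n (U \<otimes>\<^bsub>homology M n\<^esub> V) = hK (n - 1) (w \<otimes>\<^bsub>grp K (n - 1)\<^esub> w')"
      using connecting_lifts[OF lifts_mult[OF U(1) V(1)]] by simp
    then show "connecting n (U \<otimes>\<^bsub>homology M n\<^esub> V) =
        connecting n U \<otimes>\<^bsub>homology K (n - 1)\<^esub> connecting n V"
      using U V lifts_cycles(2) by (simp add: connecting_lifts I.C.hclass_mult)
  qed
  then show ?thesis
    using I.C.comm_group_homology P.D.comm_group_homology
    by (simp add: group_hom_def group_hom_axioms_def comm_group_def)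
qed

lemma kernel_connecting:
  "kernel (homology M n) (homology K (n - 1)) (connecting n) =
     {hM n (p n y) | y w. lifts n y w \<and> w \<in> boundaries K (n - 1)}"
proof -
  have "connecting n (hM n (p n y)) = \<one>\<^bsub>homology K (n - 1)\<^esub> \<longleftrightarrow> w \<in> boundaries K (n - 1)"
    if "lifts n y w" for y w
  proof -
    have "w \<in> carrier (grp K (n - 1))"
      using that by (simp add: lifts_def)
    then show ?thesis
      using that by (simp add: connecting_lifts I.C.hclass_eq_one_iff)
  qed
  moreover have "hM n (p n y) \<in> carrier (homology M n)" if "lifts n y w" for y w
    using lifts_cycles(1)[OF that] by (auto simp: P.D.carrier_homology)
  ultimately show ?thesis
    unfolding kernel_def by (blast elim: homology_lifts)
qed

lemma image_connecting:
  "connecting n ` carrier (homology M n) = {hK (n - 1) w | y w. lifts n y w}"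
proof -
  have "hM n (p n y) \<in> carrier (homology M n)" if "lifts n y w" for y w
    using lifts_cycles(1)[OF that] by (auto simp: P.D.carrier_homology)
  then have "carrier (homology M n) = {hM n (p n y) | y w. lifts n y w}"
    by (blast elim: homology_lifts)
  moreover have "connecting n ` {hM n (p n y) | y w. lifts n y w} =
      {connecting n (hM n (p n y)) | y w. lifts n y w}"
    by blast
  moreover have "\<dots> = {hK (n - 1) w | y w. lifts n y w}"
    by (metis connecting_lifts)
  ultimately show ?thesis
    by simp
qed

lemma exact_at_L:
  "exact_at (homology K n) (homology_map L i n) (homology L n) (homology_map M p n) (homology M n)"
proof -
  have "hL n y \<in> hL n ` i n ` cycles K n" if y: "y \<in> cycles L n" "p n y \<in> boundaries M n" for y
  proof -
    have yc: "y \<in> carrier (grp L n)" "bd L n y = \<one>\<^bsub>grp L (n - 1)\<^esub>"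
      using y by (auto simp: I.D.mem_cycles_iff)
    obtain k l where k: "k \<in> carrier (grp K n)" and l: "l \<in> carrier (grp L (n + 1))"
      and yk: "y = i n k \<otimes>\<^bsub>grp L n\<^esub> bd L (n + 1) l"
      using p_in_boundaries[OF yc(1) y(2)] .
    \<comment> \<open>As \<open>y\<close> is a cycle and the other factor is a boundary,
      \<open>i n k\<close> is a cycle; injectivity of \<open>i\<close> passes this on to
      \<open>k\<close>, which then represents the class of \<open>y\<close>.\<close>
    have "bd L n (i n k) = \<one>\<^bsub>grp L (n - 1)\<^esub>"
      using yc(2) k l by (simp add: yk)
    then have "bd K n k = \<one>\<^bsub>grp K (n - 1)\<^esub>"
      using i_eq_one_iff[OF I.C.D.hom_closed[OF k]] k by (simp add: I.map_bd)
    then have kc: "k \<in> cycles K n"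
      using k by (simp add: I.C.mem_cycles_iff)
    have "y \<otimes>\<^bsub>grp L n\<^esub> inv\<^bsub>grp L n\<^esub> i n k = bd L (n + 1) l"
      using k l by (simp add: yk I.D.G.m_comm[of "i n k"] I.D.G.m_assoc)
    then have "hL n y = hL n (i n k)"
      using k l yc by (simp add: I.D.hclass_eq_iff boundaries_def)
    then show ?thesis
      using kc by blast
  qed
  moreover have "p n (i n k) \<in> boundaries M n" if "k \<in> cycles K n" for k
    using that P.D.subgroup_boundaries[of n] by (simp add: I.C.mem_cycles_iff p_i subgroup.one_closed)
  ultimately show ?thesis
    using I.group_hom_homology_map P.group_hom_homology_map I.map_cycles
    unfolding exact_at_def I.image_homology_map P.kernel_homology_map by blast
qed

lemma exact_at_M:
  "exact_at (homology L n) (homology_map M p n) (homology M n) (connecting n) (homology K (n - 1))"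
proof -
  have "hM n (p n y) \<in> hM n ` p n ` cycles L n" if y: "lifts n y w" "w \<in> boundaries K (n - 1)" for y w
  proof -
    have yc: "y \<in> carrier (grp L n)" and e: "i (n - 1) w = bd L n y"
      using y by (auto simp: lifts_def)
    obtain k where k: "k \<in> carrier (grp K n)" "w = bd K n k"
      using y(2) by (auto simp: boundaries_def)
    \<comment> \<open>Dividing by \<open>i n k\<close> makes the lift a cycle without changing its
      image in \<open>M\<close>.\<close>
    let ?y = "y \<otimes>\<^bsub>grp L n\<^esub> inv\<^bsub>grp L n\<^esub> i n k"
    have "?y \<in> cycles L n"
      using yc k e I.map_bd[OF k(1)] by (simp add: I.D.mem_cycles_iff)
    moreover have "p n ?y = p n y"
      using yc k by (simp add: p_i)
    ultimately show ?thesis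
      by (metis imageI)
  qed
  \<comment> \<open>A cycle of \<open>L\<close> has trivial boundary, so the identity of
    \<open>K\<close> serves as \<open>w\<close>.\<close>
  moreover have "\<exists>w. lifts n y w \<and> w \<in> boundaries K (n - 1)" if "y \<in> cycles L n" for y
    using that I.C.subgroup_boundaries[of "n - 1"]
    by (intro exI[of _ "\<one>\<^bsub>grp K (n - 1)\<^esub>"]) (simp add: lifts_def I.D.mem_cycles_iff subgroup.one_closed)
  ultimately have "hM n ` p n ` cycles L n = {hM n (p n y) | y w. lifts n y w \<and> w \<in> boundaries K (n - 1)}"
    by blast
  then show ?thesis
    using P.group_hom_homology_map group_hom_connecting
    unfolding exact_at_def P.image_homology_map kernel_connecting by simp
qed

text \<open>The equation \<open>i (n - 1) w = bd L n y\<close> in \<open>lifts\<close> can be read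
  both ways: \<open>w\<close> belongs to a lift, and the image of \<open>w\<close> bounds.\<close>

lemma exact_at_K:
  "exact_at (homology M n) (connecting n) (homology K (n - 1)) (homology_map L i (n - 1)) (homology L (n - 1))"
proof -
  have "w \<in> cycles K (n - 1) \<and> i (n - 1) w \<in> boundaries L (n - 1)" if "lifts n y w" for y w
    using that lifts_cycles(2)[OF that] by (simp add: lifts_def I.D.bd_in_boundaries)
  moreover have "\<exists>y. lifts n y w" if "w \<in> cycles K (n - 1)" "i (n - 1) w \<in> boundaries L (n - 1)" for w
    using that by (auto simp: lifts_def boundaries_def I.C.mem_cycles_iff)
  ultimately have "{hK (n - 1) w | y w. lifts n y w} =
      hK (n - 1) ` {z \<in> cycles K (n - 1). i (n - 1) z \<in> boundaries L (n - 1)}"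
    by blast
  then show ?thesis
    using I.group_hom_homology_map group_hom_connecting
    unfolding exact_at_def I.kernel_homology_map image_connecting by simp
qed

end

section \<open>Subcomplexes and their quotient complexes\<close>

locale subcomplex = chain_complex C for C :: "'c chain_cx" +
  fixes N :: "int \<Rightarrow> 'c set"
  assumes sub: "subgroup (N n) (grp C n)"
    and bd_sub: "x \<in> N n \<Longrightarrow> bd C n x \<in> N (n - 1)"
begin

lemma bd_quotient:
  "x \<in> carrier (grp C n) \<Longrightarrow>
     bd (quotient_cx C N) n (N n #>\<^bsub>grp C n\<^esub> x) = N (n - 1) #>\<^bsub>grp C (n - 1)\<^esub> bd C n x"
  unfolding quotient_cx_def
  by (simp, rule quot_map_coset[OF D.group_hom_axioms sub sub]) (auto intro: bd_sub)

lemma grp_quotient: "grp (quotient_cx C N) n = grp C n Mod N n"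
  by (simp add: quotient_cx_def)

lemma coset_hom: "(\<lambda>x. N n #>\<^bsub>grp C n\<^esub> x) \<in> hom (grp C n) (grp (quotient_cx C N) n)"
  unfolding grp_quotient
  by (rule normal.r_coset_hom_Mod) (simp add: G.normal_iff_subgroup sub)

lemma coset_mult:
  "\<lbrakk>x \<in> carrier (grp C n); y \<in> carrier (grp C n)\<rbrakk> \<Longrightarrow>
     (N n #>\<^bsub>grp C n\<^esub> x) \<otimes>\<^bsub>grp (quotient_cx C N) n\<^esub> (N n #>\<^bsub>grp C n\<^esub> y) =
       N n #>\<^bsub>grp C n\<^esub> (x \<otimes>\<^bsub>grp C n\<^esub> y)"
  by (rule hom_mult[OF coset_hom, symmetric])

lemma quotient_carrierE:
  assumes "U \<in> carrier (grp (quotient_cx C N) n)"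
  obtains x where "x \<in> carrier (grp C n)" "U = N n #>\<^bsub>grp C n\<^esub> x"
  using assms by (auto simp: grp_quotient carrier_FactGroup)

lemma chain_complex_quotient: "chain_complex (quotient_cx C N)"
proof (rule chain_complex.intro)
  fix n
  show "comm_group (grp (quotient_cx C N) n)"
    unfolding grp_quotient by (rule G.abelian_FactGroup[OF sub])
  show "bd (quotient_cx C N) n \<in> hom (grp (quotient_cx C N) n) (grp (quotient_cx C N) (n - 1))"
  proof (rule homI)
    fix U assume "U \<in> carrier (grp (quotient_cx C N) n)"
    then show "bd (quotient_cx C N) n U \<in> carrier (grp (quotient_cx C N) (n - 1))"
      by (auto elim!: quotient_carrierE simp: bd_quotient hom_in_carrier[OF coset_hom])
  next
    fix U V
    assume "U \<in> carrier (grp (quotient_cx C N) n)" "V \<in> carrier (grp (quotient_cx C N) n)"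
    then obtain x y where "x \<in> carrier (grp C n)" "U = N n #>\<^bsub>grp C n\<^esub> x"
      "y \<in> carrier (grp C n)" "V = N n #>\<^bsub>grp C n\<^esub> y"
      by (metis quotient_carrierE)
    then show "bd (quotient_cx C N) n (U \<otimes>\<^bsub>grp (quotient_cx C N) n\<^esub> V) =
      bd (quotient_cx C N) n U \<otimes>\<^bsub>grp (quotient_cx C N) (n - 1)\<^esub> bd (quotient_cx C N) n V"
      by (simp add: coset_mult bd_quotient)
  qed
next
  fix n U assume "U \<in> carrier (grp (quotient_cx C N) n)"
  then obtain x where x: "x \<in> carrier (grp C n)" "U = N n #>\<^bsub>grp C n\<^esub> x"
    by (rule quotient_carrierE)
  then show "bd (quotient_cx C N) (n - 1) (bd (quotient_cx C N) n U) =
      \<one>\<^bsub>grp (quotient_cx C N) (n - 1 - 1)\<^esub>"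
    using bd_quotient[OF x(1)] bd_quotient[OF D.hom_closed[OF x(1)]] bd_bd[OF x(1)]
      G.coset_join2[OF G.one_closed sub subgroup.one_closed[OF sub], of "n - 1 - 1"]
    by (simp add: grp_quotient)
qed

sublocale Q: chain_complex "quotient_cx C N"
  by (rule chain_complex_quotient)

sublocale proj: chain_map C "quotient_cx C N" "\<lambda>n x. N n #>\<^bsub>grp C n\<^esub> x"
  by unfold_locales (auto intro: coset_hom simp: bd_quotient)

lemma proj_surj: "(\<lambda>x. N n #>\<^bsub>grp C n\<^esub> x) ` carrier (grp C n) = carrier (grp (quotient_cx C N) n)"
  by (simp add: grp_quotient carrier_FactGroup)

lemma proj_eq_one_iff:
  "x \<in> carrier (grp C n) \<Longrightarrow>
     N n #>\<^bsub>grp C n\<^esub> x = \<one>\<^bsub>grp (quotient_cx C N) n\<^esub> \<longleftrightarrow> x \<in> N n"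
  using G.coset_join1[OF _ _ sub] G.coset_join2[OF _ sub] by (auto simp: grp_quotient)

lemma proj_kernel: "kernel (grp C n) (grp (quotient_cx C N) n) (\<lambda>x. N n #>\<^bsub>grp C n\<^esub> x) = N n"
  unfolding kernel_def using subgroup.subset[OF sub] proj_eq_one_iff by blast

end

text \<open>Surjectivity and exactness in the middle hold by construction for the quotient by the
  image of \<open>f\<close>; the assumption \<open>inj\<close> supplies the remaining
  condition.\<close>

lemma (in chain_map) long_exact_sequence:
  assumes inj: "\<And>n. inj_on (f n) (carrier (grp C n))"
  shows "long_exact_sequence C D f"
proof -
  interpret subcomplex D "\<lambda>n. f n ` carrier (grp C n)"
    by (intro subcomplex.intro subcomplex_axioms.intro D.chain_complex_axioms F.img_is_subgroup)
      (auto simp flip: map_bd)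
  interpret short_exact_sequence C D "relative_cx C D f" f "relative_proj C D f"
    unfolding relative_cx_def relative_proj_def
    by unfold_locales (auto simp: inj proj_surj proj_kernel)
  show ?thesis
    unfolding long_exact_sequence_def Let_def
    using exact_at_L exact_at_M exact_at_K by blast
qed

section \<open>Closure spaces and their products\<close>

lemma closure_spaceD:
  assumes "closure_space X"
  shows "cl X {} = {}"
    and "A \<subseteq> points X \<Longrightarrow> A \<subseteq> cl X A"
    and "A \<subseteq> points X \<Longrightarrow> cl X A \<subseteq> points X"
    and "\<lbrakk>A \<subseteq> points X; B \<subseteq> points X\<rbrakk> \<Longrightarrow> cl X (A \<union> B) = cl X A \<union> cl X B"
  using assms by (auto simp: closure_space_def)

lemma cl_mono:
  assumes "closure_space X" "A \<subseteq> B" "B \<subseteq> points X"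
  shows "cl X A \<subseteq> cl X B"
  using closure_spaceD(4)[OF assms(1), of A B] assms(2,3) by (auto simp: sup.absorb2)

lemma ccontinuous_compose:
  assumes "ccontinuous X Y f" "ccontinuous Y Z g"
  shows "ccontinuous X Z (g \<circ> f)"
proof -
  have f: "f \<in> points X \<rightarrow> points Y" "\<And>A. A \<subseteq> points X \<Longrightarrow> f ` cl X A \<subseteq> cl Y (f ` A)"
    and g: "g \<in> points Y \<rightarrow> points Z" "\<And>A. A \<subseteq> points Y \<Longrightarrow> g ` cl Y A \<subseteq> cl Z (g ` A)"
    using assms by (auto simp: ccontinuous_def)
  have "g ` f ` cl X A \<subseteq> cl Z (g ` f ` A)" if "A \<subseteq> points X" for A
  proof -
    have "f ` A \<subseteq> points Y"
      using f(1) that by blast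
    then show ?thesis
      using f(2)[OF that] g(2)[of "f ` A"] by blast
  qed
  then show ?thesis
    using f(1) g(1) by (auto simp: ccontinuous_def image_comp)
qed

text \<open>Closures of sets of points consist of points, so continuity sees only the values there.
  This makes it harmless to restrict faces to extensional functions.\<close>

lemma ccontinuous_cong:
  assumes "closure_space X" and eq: "\<And>x. x \<in> points X \<Longrightarrow> f x = g x"
  shows "ccontinuous X Y f \<longleftrightarrow> ccontinuous X Y g"
proof -
  have "f ` A = g ` A" if "A \<subseteq> points X" for A
    using that eq by (intro image_cong) auto
  moreover have "f ` cl X A = g ` cl X A" if "A \<subseteq> points X" for A
    using closure_spaceD(3)[OF assms(1) that] eq by (intro image_cong) auto
  ultimately show ?thesis
    using eq by (auto simp: ccontinuous_def Pi_iff)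
qed

lemma ccontinuous_restrict:
  "closure_space X \<Longrightarrow> ccontinuous X Y (restrict f (points X)) \<longleftrightarrow> ccontinuous X Y f"
  by (rule ccontinuous_cong) (simp_all only: restrict_apply' simp_thms)

lemma ccontinuous_subspace:
  assumes "A \<subseteq> points X" "ccontinuous Y (subspace X A) f"
  shows "ccontinuous Y X f"
  using assms by (auto simp: ccontinuous_def subspace_def)

lemma closure_space_indiscrete: "closure_space (indiscrete S)"
  by (auto simp: closure_space_def indiscrete_def)

lemma closure_space_upward: "closure_space (upward S)"
  by (auto simp: closure_space_def upward_def)

lemma closure_space_topology: "closure_space (cspace_of_topology T)"
  using closure_of_subset[of _ T] closure_of_subset_topspace[of T]
  by (auto simp: closure_space_def cspace_of_topology_def)

lemma ccontinuous_topology: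
  assumes "continuous_map T T' f"
  shows "ccontinuous (cspace_of_topology T) (cspace_of_topology T') f"
  using continuous_map_image_closure_subset[OF assms] continuous_map_funspace[OF assms]
  by (simp add: ccontinuous_def cspace_of_topology_def)

section \<open>Neighborhoods and closures given by a neighborhood base\<close>

lemma neighborhoods_subset: "V \<in> neighborhoods X x \<Longrightarrow> V \<subseteq> points X"
  by (simp add: neighborhoods_def)

lemma neighborhoods_mem: "\<lbrakk>closure_space X; V \<in> neighborhoods X x\<rbrakk> \<Longrightarrow> x \<in> V"
  using closure_spaceD(2)[of X "points X - V"] by (auto simp: neighborhoods_def cinterior_def)

lemma neighborhoods_points: "\<lbrakk>closure_space X; x \<in> points X\<rbrakk> \<Longrightarrow> points X \<in> neighborhoods X x"
  by (simp add: neighborhoods_def cinterior_def closure_spaceD)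

lemma neighborhoods_mono:
  assumes "closure_space X" "V \<in> neighborhoods X x" "V \<subseteq> W" "W \<subseteq> points X"
  shows "W \<in> neighborhoods X x"
  using cl_mono[OF assms(1), of "points X - W" "points X - V"] assms
  by (auto simp: neighborhoods_def cinterior_def)

lemma neighborhoods_Int:
  assumes "closure_space X" "V \<in> neighborhoods X x" "W \<in> neighborhoods X x"
  shows "V \<inter> W \<in> neighborhoods X x"
  using assms closure_spaceD(4)[OF assms(1), of "points X - V" "points X - W"]
  by (auto simp: neighborhoods_def cinterior_def Diff_Int)

lemma neighborhoods_vimage:
  assumes X: "closure_space X" and Y: "closure_space Y" and f: "ccontinuous X Y f"
    and x: "x \<in> points X" and V: "V \<in> neighborhoods Y (f x)"
  shows "{w \<in> points X. f w \<in> V} \<in> neighborhoods X x"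
proof -
  let ?U = "{w \<in> points X. f w \<in> V}"
  have "x \<notin> cl X (points X - ?U)"
  proof
    assume "x \<in> cl X (points X - ?U)"
    then have "f x \<in> cl Y (f ` (points X - ?U))"
      using f unfolding ccontinuous_def by (metis (no_types, lifting) Diff_subset image_subset_iff)
    moreover have "f ` (points X - ?U) \<subseteq> points Y - V"
      using f by (auto simp: ccontinuous_def)
    ultimately have "f x \<in> cl Y (points Y - V)"
      using cl_mono[OF Y] by blast
    then show False
      using V by (simp add: neighborhoods_def cinterior_def)
  qed
  then show ?thesis
    using x by (auto simp: neighborhoods_def cinterior_def)
qed

text \<open>\<open>ne\<close> gives the closure of the empty set, \<open>mem\<close> makes the
  closure extensive, and \<open>dir\<close> gives additivity: a basic set missing \<open>A\<close>
  and one missing \<open>B\<close> contain a common basic set missing both.\<close>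

lemma closure_space_from_nbhd_base:
  assumes ne: "\<And>x. x \<in> S \<Longrightarrow> \<B> x \<noteq> {}"
    and mem: "\<And>x N. \<lbrakk>x \<in> S; N \<in> \<B> x\<rbrakk> \<Longrightarrow> x \<in> N"
    and dir: "\<And>x N N'. \<lbrakk>x \<in> S; N \<in> \<B> x; N' \<in> \<B> x\<rbrakk> \<Longrightarrow> \<exists>N''\<in>\<B> x. N'' \<subseteq> N \<inter> N'"
  shows "closure_space (from_nbhd_base S \<B>)"
proof -
  have "x \<in> cl (from_nbhd_base S \<B>) A \<or> x \<in> cl (from_nbhd_base S \<B>) B"
    if "x \<in> cl (from_nbhd_base S \<B>) (A \<union> B)" for x A B
  proof (rule ccontr)
    assume n: "\<not> ?thesis"
    have "x \<in> S"
      using that by (auto simp: from_nbhd_base_def)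
    then obtain N N' where "N \<in> \<B> x" "N \<inter> A = {}" "N' \<in> \<B> x" "N' \<inter> B = {}"
      using n by (auto simp: from_nbhd_base_def)
    then obtain N'' where "N'' \<in> \<B> x" "N'' \<inter> (A \<union> B) = {}"
      using dir[OF \<open>x \<in> S\<close>, of N N'] by blast
    then show False
      using that unfolding from_nbhd_base_def by auto
  qed
  then have "cl (from_nbhd_base S \<B>) (A \<union> B) = cl (from_nbhd_base S \<B>) A \<union> cl (from_nbhd_base S \<B>) B" for A B
    by (auto simp: from_nbhd_base_def)
  moreover have "cl (from_nbhd_base S \<B>) {} = {}"
    using ne by (auto simp: from_nbhd_base_def)
  moreover have "A \<subseteq> cl (from_nbhd_base S \<B>) A" if "A \<subseteq> S" for A
    using that mem unfolding from_nbhd_base_def by fastforce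
  moreover have "points (from_nbhd_base S \<B>) = S" "cl (from_nbhd_base S \<B>) A \<subseteq> S" for A
    by (auto simp: from_nbhd_base_def)
  ultimately show ?thesis
    unfolding closure_space_def by simp
qed

lemma ccontinuous_from_nbhd_base:
  assumes W: "closure_space W" and f: "f \<in> points W \<rightarrow> S"
    and nb: "\<And>x N. \<lbrakk>x \<in> points W; N \<in> \<B> (f x)\<rbrakk> \<Longrightarrow> {w \<in> points W. f w \<in> N} \<in> neighborhoods W x"
  shows "ccontinuous W (from_nbhd_base S \<B>) f"
proof -
  have "f x \<in> cl (from_nbhd_base S \<B>) (f ` A)" if A: "A \<subseteq> points W" and x: "x \<in> cl W A" for A x
  proof -
    have xW: "x \<in> points W"
      using closure_spaceD(3)[OF W A] x by blast
    have "N \<inter> f ` A \<noteq> {}" if N: "N \<in> \<B> (f x)" for N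
    proof
      assume "N \<inter> f ` A = {}"
      then have "A \<subseteq> points W - {w \<in> points W. f w \<in> N}"
        using A by auto
      from cl_mono[OF W this] have "x \<in> cl W (points W - {w \<in> points W. f w \<in> N})"
        using x by blast
      then show False
        using nb[OF xW N] by (simp add: neighborhoods_def cinterior_def)
    qed
    then show ?thesis
      using f xW by (auto simp: from_nbhd_base_def)
  qed
  then show ?thesis
    using f by (auto simp: ccontinuous_def from_nbhd_base_def)
qed

section \<open>Relabelled spaces\<close>

lemma points_relabel [simp]: "points (relabel f X) = f ` points X"
  by (simp add: relabel_def)

lemma closure_space_relabel:
  assumes X: "closure_space X"
  shows "closure_space (relabel f X)"
proof -
  let ?P = "\<lambda>B. {x \<in> points X. f x \<in> B}"
  have "?P (A \<union> B) = ?P A \<union> ?P B" for A B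
    by auto
  then have "cl X (?P (A \<union> B)) = cl X (?P A) \<union> cl X (?P B)" for A B
    using closure_spaceD(4)[OF X, of "?P A" "?P B"] by simp
  moreover have "A \<subseteq> f ` cl X (?P A)" if "A \<subseteq> f ` points X" for A
  proof -
    have "A = f ` ?P A"
      using that by auto
    also have "\<dots> \<subseteq> f ` cl X (?P A)"
      by (intro image_mono closure_spaceD(2)[OF X]) auto
    finally show ?thesis .
  qed
  moreover have "cl X (?P A) \<subseteq> points X" for A
    using closure_spaceD(3)[OF X, of "?P A"] by auto
  ultimately show ?thesis
    using closure_spaceD(1)[OF X] by (auto simp: closure_space_def relabel_def image_Un image_subset_iff subset_iff)
qed

lemma ccontinuous_relabel:
  assumes "closure_space X"
  shows "ccontinuous X (relabel f X) f"
proof -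
  have "cl X A \<subseteq> cl X {x \<in> points X. f x \<in> f ` A}" if "A \<subseteq> points X" for A
    using that by (intro cl_mono[OF assms]) auto
  then show ?thesis
    by (simp add: ccontinuous_def relabel_def image_mono)
qed

text \<open>\<open>relabel f X\<close> behaves as a final structure: continuity out of it is tested
  after composing with \<open>f\<close>.\<close>

lemma ccontinuous_from_relabel:
  assumes Y: "closure_space Y" and h: "ccontinuous X Y (h \<circ> f)"
  shows "ccontinuous (relabel f X) Y h"
proof -
  have "h ` f ` cl X {x \<in> points X. f x \<in> A} \<subseteq> cl Y (h ` A)" if "A \<subseteq> f ` points X" for A
  proof -
    have "h ` f ` cl X {x \<in> points X. f x \<in> A} \<subseteq> cl Y (h ` f ` {x \<in> points X. f x \<in> A})"
      using h by (auto simp: ccontinuous_def image_comp)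
    also have "f ` {x \<in> points X. f x \<in> A} = A"
      using that by auto
    finally show ?thesis .
  qed
  then show ?thesis
    using h by (auto simp: ccontinuous_def relabel_def Pi_iff)
qed

text \<open>The two products differ only in the basic set at \<open>(x, y)\<close> formed from
  \<open>U\<close> and \<open>V\<close>: the rectangle or the cross. The centre is an argument of
  \<open>box\<close> because the cross depends on it. The conditions hold for both shapes.\<close>

locale basic_box =
  fixes box :: "'a \<Rightarrow> 'b \<Rightarrow> 'a set \<Rightarrow> 'b set \<Rightarrow> ('a \<times> 'b) set"
  assumes box_mono: "\<lbrakk>U \<subseteq> U'; V \<subseteq> V'\<rbrakk> \<Longrightarrow> box x y U V \<subseteq> box x y U' V'"
    and slice_box: "x \<in> U \<Longrightarrow> {x} \<times> V \<subseteq> box x y U V"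
    and box_subset: "\<lbrakk>x \<in> U; y \<in> V\<rbrakk> \<Longrightarrow> box x y U V \<subseteq> U \<times> V"
    and box_map_snd: "f ` V \<subseteq> W \<Longrightarrow> (\<lambda>(x, y). (x, f y)) ` box x y U V \<subseteq> box x (f y) U W"
begin

definition box_nbhds :: "'a cspace \<Rightarrow> 'b cspace \<Rightarrow> 'a \<times> 'b \<Rightarrow> ('a \<times> 'b) set set" where
  "box_nbhds X Y = (\<lambda>(x, y). {box x y U V | U V. U \<in> neighborhoods X x \<and> V \<in> neighborhoods Y y})"

definition box_product :: "'a cspace \<Rightarrow> 'b cspace \<Rightarrow> ('a \<times> 'b) cspace" where
  "box_product X Y = from_nbhd_base (points X \<times> points Y) (box_nbhds X Y)"

lemma points_box_product [simp]: "points (box_product X Y) = points X \<times> points Y"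
  by (simp add: box_product_def from_nbhd_base_def)

lemma closure_space_box_product:
  assumes X: "closure_space X" and Y: "closure_space Y"
  shows "closure_space (box_product X Y)"
  unfolding box_product_def
proof (rule closure_space_from_nbhd_base)
  fix p assume "p \<in> points X \<times> points Y"
  then obtain x y where p: "p = (x, y)" "x \<in> points X" "y \<in> points Y"
    by auto
  show "box_nbhds X Y p \<noteq> {}"
    using neighborhoods_points[OF X p(2)] neighborhoods_points[OF Y p(3)] p(1)
    by (auto simp: box_nbhds_def)
  \<comment> \<open>The centre lies on the slice \<open>{x} \<times> V\<close>, which every basic
    set contains.\<close>
  show "p \<in> N" if "N \<in> box_nbhds X Y p" for N
    using that neighborhoods_mem[OF X] neighborhoods_mem[OF Y] slice_box p(1)
    by (fastforce simp: box_nbhds_def)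
  show "\<exists>N''\<in>box_nbhds X Y p. N'' \<subseteq> N \<inter> N'" if "N \<in> box_nbhds X Y p" "N' \<in> box_nbhds X Y p" for N N'
  proof -
    obtain U V U' V' where "N = box x y U V" "N' = box x y U' V'"
      and nb: "U \<in> neighborhoods X x" "V \<in> neighborhoods Y y" "U' \<in> neighborhoods X x" "V' \<in> neighborhoods Y y"
      using \<open>N \<in> _\<close> \<open>N' \<in> _\<close> p(1) unfolding box_nbhds_def by auto
    then have "box x y (U \<inter> U') (V \<inter> V') \<subseteq> N \<inter> N'"
      using box_mono[of "U \<inter> U'" _ "V \<inter> V'"] by simp
    then show ?thesis
      using neighborhoods_Int[OF X nb(1,3)] neighborhoods_Int[OF Y nb(2,4)] p(1)
      unfolding box_nbhds_def by blast
  qed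
qed

lemma neighborhoods_box_product:
  assumes X: "closure_space X" and Y: "closure_space Y" and xy: "x \<in> points X" "y \<in> points Y"
    and nb: "U \<in> neighborhoods X x" "V \<in> neighborhoods Y y"
    and W: "box x y U V \<subseteq> W" "W \<subseteq> points X \<times> points Y"
  shows "W \<in> neighborhoods (box_product X Y) (x, y)"
proof -
  have "N \<subseteq> points X \<times> points Y" if N: "N \<in> box_nbhds X Y (x, y)" for N
  proof -
    obtain U V where N: "N = box x y U V"
      and nb: "U \<in> neighborhoods X x" "V \<in> neighborhoods Y y"
      using N by (auto simp: box_nbhds_def)
    have "N \<subseteq> U \<times> V"
      unfolding N by (rule box_subset[OF neighborhoods_mem[OF X nb(1)] neighborhoods_mem[OF Y nb(2)]])
    then show ?thesis
      using neighborhoods_subset[OF nb(1)] neighborhoods_subset[OF nb(2)] by blast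
  qed
  then have "neighborhoods (box_product X Y) (x, y) =
      {V. V \<subseteq> points X \<times> points Y \<and> (\<exists>N\<in>box_nbhds X Y (x, y). N \<subseteq> V)}"
    unfolding box_product_def using xy by (intro neighborhoods_from_nbhd_base) simp_all
  moreover have "box x y U V \<in> box_nbhds X Y (x, y)"
    using nb by (auto simp: box_nbhds_def)
  ultimately show ?thesis
    using W by blast
qed

text \<open>A basic set at \<open>(x, y)\<close> contains \<open>{x} \<times> V\<close>, so its
  preimage under \<open>Pair x\<close> contains the neighborhood \<open>V\<close>.\<close>

lemma ccontinuous_slice:
  assumes X: "closure_space X" and Y: "closure_space Y" and x: "x \<in> points X"
  shows "ccontinuous Y (box_product X Y) (Pair x)"
  unfolding box_product_def
proof (rule ccontinuous_from_nbhd_base[OF Y])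
  fix y N assume y: "y \<in> points Y" and "N \<in> box_nbhds X Y (x, y)"
  then obtain U V where N: "N = box x y U V"
    and nb: "U \<in> neighborhoods X x" "V \<in> neighborhoods Y y"
    by (auto simp: box_nbhds_def)
  have "V \<subseteq> {w \<in> points Y. (x, w) \<in> N}"
    using slice_box[OF neighborhoods_mem[OF X nb(1)], of V y] neighborhoods_subset[OF nb(2)] N by auto
  then show "{w \<in> points Y. (x, w) \<in> N} \<in> neighborhoods Y y"
    by (rule neighborhoods_mono[OF Y nb(2)]) auto
qed (use x in auto)

text \<open>Pull \<open>V\<close> back along \<open>f\<close>: the box over \<open>U\<close> and the
  preimage of \<open>V\<close> is sent into the box over \<open>U\<close> and \<open>V\<close>. For
  the cross this uses that the arm through \<open>y\<close> goes to the arm through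
  \<open>f y\<close>.\<close>

lemma ccontinuous_map_snd:
  assumes X: "closure_space X" and Y: "closure_space Y" and Z: "closure_space Z"
    and f: "ccontinuous Y Z f"
  shows "ccontinuous (box_product X Y) (box_product X Z) (\<lambda>(x, y). (x, f y))"
proof -
  have fYZ: "f \<in> points Y \<rightarrow> points Z"
    using f by (simp add: ccontinuous_def)
  have "{w \<in> points X \<times> points Y. (\<lambda>(x, y). (x, f y)) w \<in> N} \<in> neighborhoods (box_product X Y) (x, y)"
    if xy: "x \<in> points X" "y \<in> points Y" and N: "N \<in> box_nbhds X Z (x, f y)" for x y N
  proof -
    obtain U V where N: "N = box x (f y) U V"
      and nb: "U \<in> neighborhoods X x" "V \<in> neighborhoods Z (f y)"
      using N by (auto simp: box_nbhds_def)
    let ?V = "{w \<in> points Y. f w \<in> V}"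
    have V: "?V \<in> neighborhoods Y y"
      by (rule neighborhoods_vimage[OF Y Z f xy(2) nb(2)])
    have "box x y U ?V \<subseteq> points X \<times> points Y"
      using box_subset[OF neighborhoods_mem[OF X nb(1)] neighborhoods_mem[OF Y V]]
        neighborhoods_subset[OF nb(1)] by blast
    moreover have "f ` ?V \<subseteq> V"
      by auto
    then have "(\<lambda>(x, y). (x, f y)) ` box x y U ?V \<subseteq> N"
      unfolding N by (rule box_map_snd)
    ultimately show ?thesis
      by (intro neighborhoods_box_product[OF X Y xy nb(1) V]) auto
  qed
  then show ?thesis
    unfolding box_product_def[of X Z] using fYZ
    by (intro ccontinuous_from_nbhd_base closure_space_box_product X Y) auto
qed

end

lemma basic_box_Times: "basic_box (\<lambda>x y U V. U \<times> V)"
  by unfold_locales auto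

lemma box_product_Times: "basic_box.box_product (\<lambda>x y U V. U \<times> V) = cproduct"
  by (intro ext) (simp add: basic_box.box_product_def[OF basic_box_Times]
      basic_box.box_nbhds_def[OF basic_box_Times] cproduct_def)

lemma basic_box_cross: "basic_box (\<lambda>x y U V. ({x} \<times> V) \<union> (U \<times> {y}))"
  by unfold_locales auto

lemma box_product_cross:
  "basic_box.box_product (\<lambda>x y U V. ({x} \<times> V) \<union> (U \<times> {y})) = inductive_product"
  by (intro ext) (simp add: basic_box.box_product_def[OF basic_box_cross]
      basic_box.box_nbhds_def[OF basic_box_cross] inductive_product_def)

section \<open>Singular simplices\<close>

lemma quot_map_chain_map:
  assumes "subcomplex C N" "subcomplex D N'" "chain_map C D f"
    and sub: "\<And>n x. x \<in> N n \<Longrightarrow> f n x \<in> N' n"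
  shows "chain_map (quotient_cx C N) (quotient_cx D N') (\<lambda>n. quot_map (grp D n) (N' n) (f n))"
proof -
  interpret C: subcomplex C N by fact
  interpret D: subcomplex D N' by fact
  interpret chain_map C D f by fact
  have q: "quot_map (grp D n) (N' n) (f n) (N n #>\<^bsub>grp C n\<^esub> x) = N' n #>\<^bsub>grp D n\<^esub> f n x"
    if "x \<in> carrier (grp C n)" for n x
    using that by (intro quot_map_coset F.group_hom_axioms C.sub D.sub) (auto intro: sub)
  show ?thesis
  proof (intro chain_map.intro chain_map_axioms.intro C.chain_complex_quotient D.chain_complex_quotient)
    fix n
    show "quot_map (grp D n) (N' n) (f n) \<in> hom (grp (quotient_cx C N) n) (grp (quotient_cx D N') n)"
    proof (rule homI)
      fix U assume "U \<in> carrier (grp (quotient_cx C N) n)"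
      then show "quot_map (grp D n) (N' n) (f n) U \<in> carrier (grp (quotient_cx D N') n)"
        by (auto elim!: C.quotient_carrierE simp: q hom_in_carrier[OF D.coset_hom])
    next
      fix U V
      assume "U \<in> carrier (grp (quotient_cx C N) n)" "V \<in> carrier (grp (quotient_cx C N) n)"
      then obtain x y where "x \<in> carrier (grp C n)" "U = N n #>\<^bsub>grp C n\<^esub> x"
        "y \<in> carrier (grp C n)" "V = N n #>\<^bsub>grp C n\<^esub> y"
        by (metis C.quotient_carrierE)
      then show "quot_map (grp D n) (N' n) (f n) (U \<otimes>\<^bsub>grp (quotient_cx C N) n\<^esub> V) =
        quot_map (grp D n) (N' n) (f n) U \<otimes>\<^bsub>grp (quotient_cx D N') n\<^esub> quot_map (grp D n) (N' n) (f n) V"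
        by (simp only: C.coset_mult D.coset_mult q C.G.m_closed F.hom_mult F.hom_closed)
    qed
  next
    fix n U assume "U \<in> carrier (grp (quotient_cx C N) n)"
    then obtain x where x: "x \<in> carrier (grp C n)" "U = N n #>\<^bsub>grp C n\<^esub> x"
      by (rule C.quotient_carrierE)
    then show "quot_map (grp D (n - 1)) (N' (n - 1)) (f (n - 1)) (bd (quotient_cx C N) n U) =
        bd (quotient_cx D N') n (quot_map (grp D n) (N' n) (f n) U)"
      by (simp add: q C.bd_quotient D.bd_quotient map_bd)
  qed
qed

text \<open>The condition \<open>iff\<close> says that \<open>N\<close> is the full preimage of
  \<open>N'\<close>, so two elements with the same image coset already differ by an element of
  \<open>N\<close>.\<close>

lemma inj_quot_map:
  assumes "group_hom G H h" "subgroup N G" "subgroup N' H"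
    and iff: "\<And>x. x \<in> carrier G \<Longrightarrow> h x \<in> N' \<longleftrightarrow> x \<in> N"
  shows "inj_on (quot_map H N' h) (carrier (G Mod N))"
proof (rule inj_onI)
  interpret group_hom G H h by fact
  fix U V
  assume UV: "U \<in> carrier (G Mod N)" "V \<in> carrier (G Mod N)" "quot_map H N' h U = quot_map H N' h V"
  then obtain x y where x: "x \<in> carrier G" "U = N #>\<^bsub>G\<^esub> x" and y: "y \<in> carrier G" "V = N #>\<^bsub>G\<^esub> y"
    by (auto simp: carrier_FactGroup)
  have "h ` N \<subseteq> N'"
    using iff subgroup.mem_carrier[OF assms(2)] by blast
  then have "N' #>\<^bsub>H\<^esub> h x = N' #>\<^bsub>H\<^esub> h y"
    using UV(3) x y by (simp add: quot_map_coset[OF assms(1-3)])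
  then have "h (x \<otimes>\<^bsub>G\<^esub> inv\<^bsub>G\<^esub> y) \<in> N'"
    using x y by (simp add: H.rcos_eq_iff[OF assms(3)])
  then show "U = V"
    using x y iff[of "x \<otimes>\<^bsub>G\<^esub> inv\<^bsub>G\<^esub> y"] by (simp add: G.rcos_eq_iff[OF assms(2)])
qed

section \<open>Complexes of free abelian groups\<close>

lemma frag_extend_frag_extend:
  "frag_extend f (frag_extend g c) = frag_extend (\<lambda>s. frag_extend f (g s)) c"
proof -
  \<comment> \<open>The trivial support bound only provides the premise that
    \<open>frag_induction\<close> consumes.\<close>
  have "Poly_Mapping.keys c \<subseteq> UNIV"
    by simp
  then show ?thesis
    by (induction c rule: frag_induction) (auto simp: frag_extend_diff)
qed

lemma frag_extend_hom:
  assumes "\<And>s. s \<in> S \<Longrightarrow> Poly_Mapping.keys (b s) \<subseteq> T"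
  shows "frag_extend b \<in> hom (free_Abelian_group S) (free_Abelian_group T)"
  using assms keys_frag_extend[of b] by (fastforce simp: hom_def frag_extend_add)

text \<open>By linearity the axioms need checking on generators only. The generators are indexed by
  naturals, so the negative and lowest integer degrees are settled here once for simplices and
  cubes.\<close>

lemma chain_complex_free:
  assumes grp: "\<And>n. grp C n = free_Abelian_group (if n < 0 then {} else S (nat n))"
    and bd: "\<And>n. bd C n = (if n \<le> 0 then (\<lambda>_. 0) else frag_extend (b (nat n)))"
    and keys: "\<And>n s. s \<in> S (Suc n) \<Longrightarrow> Poly_Mapping.keys (b (Suc n) s) \<subseteq> S n"
    and bb: "\<And>n s. s \<in> S (Suc (Suc n)) \<Longrightarrow> frag_extend (b (Suc n)) (b (Suc (Suc n)) s) = 0"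
  shows "chain_complex C"
proof (rule chain_complex.intro)
  fix n
  show "comm_group (grp C n)"
    by (simp add: grp abelian_free_Abelian_group)
  show "bd C n \<in> hom (grp C n) (grp C (n - 1))"
  proof (cases "n \<le> 0")
    case True
    then show ?thesis by (auto simp: grp bd hom_def)
  next
    case False
    then obtain m where m: "nat n = Suc m" "nat (n - 1) = m" "\<not> n < 0" "\<not> n - 1 < 0"
      by (cases "nat n") auto
    then show ?thesis
      unfolding grp bd using False keys by (simp add: frag_extend_hom)
  qed
next
  fix n x assume x: "x \<in> carrier (grp C n)"
  show "bd C (n - 1) (bd C n x) = \<one>\<^bsub>grp C (n - 1 - 1)\<^esub>"
  proof (cases "n \<le> 1")
    \<comment> \<open>In these degrees the outer boundary is the zero map by definition.\<close>
    case True
    then show ?thesis by (simp add: grp bd)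
  next
    case False
    define m where "m = nat (n - 2)"
    have m: "nat n = Suc (Suc m)" "nat (n - 1) = Suc m"
      using False by (simp_all add: m_def)
    have "frag_extend (b (Suc m)) (frag_extend (b (Suc (Suc m))) x) = 0"
      unfolding frag_extend_frag_extend
      by (rule frag_extend_eq_0) (use x bb False m in \<open>auto simp: grp\<close>)
    then show ?thesis
      using False by (simp add: grp bd m)
  qed
qed

text \<open>The usual cancellation behind a vanishing double boundary, with an abstract
  \<open>g\<close> so that it covers one double face of a simplex as well as the four signed double
  faces of a cube.\<close>

lemma alternating_double_sum:
  fixes g :: "nat \<Rightarrow> nat \<Rightarrow> 'a \<Rightarrow>\<^sub>0 int"
  assumes g: "\<And>i j. \<lbrakk>j < i; i \<le> Suc n\<rbrakk> \<Longrightarrow> g i j = g j (i - 1)"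
  shows "(\<Sum>i\<le>Suc n. \<Sum>j\<le>n. frag_cmul ((-1) ^ (i + j)) (g i j)) = 0"
proof -
  define h where "h = (\<lambda>(i, j). frag_cmul ((-1) ^ (i + j)) (g i j))"
  define A where "A = {(i, j). j < i \<and> i \<le> Suc n}"
  define B where "B = {(i, j). i \<le> j \<and> j \<le> n}"
  have AB: "{..Suc n} \<times> {..n} = A \<union> B" "A \<inter> B = {}"
    by (auto simp: A_def B_def)
  then have fin: "finite A" "finite B"
    by (metis finite_SigmaI finite_Un finite_atMost)+
  \<comment> \<open>A pair with \<open>j < i\<close> is matched with \<open>(j, i - 1)\<close>: the
    value of \<open>g\<close> is the same, and the index sum drops by one, which reverses the
    sign.\<close>
  have "sum h A = (\<Sum>p\<in>B. - h p)"
  proof (rule sum.reindex_bij_witness[of _ "\<lambda>(i, j). (Suc j, i)" "\<lambda>(i, j). (j, i - 1)"])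
    fix p assume "p \<in> A"
    then obtain i j where p: "p = (Suc i, j)" "j \<le> i" "i \<le> n"
      by (auto simp: A_def) (metis Suc_le_mono gr0_implies_Suc less_Suc_eq_le less_nat_zero_code not_gr_zero)
    then show "- h (case p of (i, j) \<Rightarrow> (j, i - 1)) = h p"
      using g[of j "Suc i"] by (simp add: h_def add.commute flip: frag_cmul_minus_one)
  qed (auto simp: A_def B_def)
  then have "sum h A + sum h B = 0"
    by (simp add: sum_negf)
  then have "sum h ({..Suc n} \<times> {..n}) = 0"
    unfolding AB(1) using fin AB(2) by (simp add: sum.union_disjoint)
  then show ?thesis
    by (simp add: sum.cartesian_product h_def)
qed

section \<open>Singular chains on a cosimplicial family of closure spaces\<close>

locale cosimplicial_cspace =
  fixes \<Delta> :: "nat \<Rightarrow> 'p cspace" and d :: "nat \<Rightarrow> 'p \<Rightarrow> 'p"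
  assumes closure_space: "closure_space (\<Delta> n)"
    and face_continuous: "i \<le> Suc n \<Longrightarrow> ccontinuous (\<Delta> n) (\<Delta> (Suc n)) (d i)"
    and face_face: "\<lbrakk>j < i; i \<le> Suc (Suc n); x \<in> points (\<Delta> n)\<rbrakk> \<Longrightarrow> d i (d j x) = d j (d (i - 1) x)"
begin

text \<open>\<open>n\<close> is the dimension of the face, one less than that of
  \<open>\<sigma>\<close>.\<close>

abbreviation face :: "nat \<Rightarrow> nat \<Rightarrow> ('p \<Rightarrow> 'a) \<Rightarrow> 'p \<Rightarrow> 'a" where
  "face n i \<sigma> \<equiv> restrict (\<sigma> \<circ> d i) (points (\<Delta> n))"

lemma face_simplex:
  assumes "\<sigma> \<in> singular_simplices \<Delta> (Suc n) X" "i \<le> Suc n"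
  shows "face n i \<sigma> \<in> singular_simplices \<Delta> n X"
  using assms ccontinuous_compose[OF face_continuous[OF assms(2)]]
  by (auto simp: singular_simplices_def ccontinuous_restrict closure_space)

lemma face_face_simplex:
  assumes "j < i" "i \<le> Suc (Suc n)"
  shows "face n j (face (Suc n) i \<sigma>) = face n (i - 1) (face (Suc n) j \<sigma>)"
proof
  fix x
  \<comment> \<open>Faces of points are points, so the inner \<open>restrict\<close> can be
    removed.\<close>
  have "d k x \<in> points (\<Delta> (Suc n))" if "x \<in> points (\<Delta> n)" "k \<le> Suc n" for k
    using face_continuous[OF that(2)] that(1) by (auto simp: ccontinuous_def)
  then show "face n j (face (Suc n) i \<sigma>) x = face n (i - 1) (face (Suc n) j \<sigma>) x"
    using assms face_face[OF assms] by auto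
qed

lemma chain_complex_singular: "chain_complex (singular_cx \<Delta> d X)"
proof (rule chain_complex_free)
  let ?b = "\<lambda>n \<sigma>. \<Sum>i\<le>n. frag_cmul ((-1) ^ i) (frag_of (face (n - 1) i \<sigma>))"
  show "grp (singular_cx \<Delta> d X) n =
      free_Abelian_group (if n < 0 then {} else singular_simplices \<Delta> (nat n) X)" for n
    by (simp add: singular_cx_def)
  show "bd (singular_cx \<Delta> d X) n = (if n \<le> 0 then (\<lambda>_. 0) else frag_extend (?b (nat n)))" for n
    by (simp add: singular_cx_def)
  show "Poly_Mapping.keys (?b (Suc n) \<sigma>) \<subseteq> singular_simplices \<Delta> n X"
    if "\<sigma> \<in> singular_simplices \<Delta> (Suc n) X" for n \<sigma>
    using face_simplex[OF that] keys_sum by (fastforce simp del: restrict_apply)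
  show "frag_extend (?b (Suc n)) (?b (Suc (Suc n)) \<sigma>) = 0" for n and \<sigma> :: "'p \<Rightarrow> 'a"
  proof -
    have "frag_extend (?b (Suc n)) (?b (Suc (Suc n)) \<sigma>) =
      (\<Sum>i\<le>Suc (Suc n). \<Sum>j\<le>Suc n. frag_cmul ((-1) ^ (i + j)) (frag_of (face n j (face (Suc n) i \<sigma>))))"
      by (simp only: frag_extend_sum finite_atMost o_def frag_extend_cmul frag_extend_of frag_cmul_sum
          frag_cmul_cmul power_add diff_Suc_1)
    also have "\<dots> = 0"
      by (rule alternating_double_sum) (simp only: face_face_simplex)
    finally show ?thesis .
  qed
qed

lemma singular_LES:
  assumes "A \<subseteq> points X"
  shows "singular_LES \<Delta> d X A"
proof -
  have sub: "singular_simplices \<Delta> n (subspace X A) \<subseteq> singular_simplices \<Delta> n X" for n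
    using ccontinuous_subspace[OF assms] by (auto simp: singular_simplices_def)
  have "chain_map (singular_cx \<Delta> d (subspace X A)) (singular_cx \<Delta> d X) (\<lambda>n c. c)"
  proof (intro chain_map.intro chain_map_axioms.intro chain_complex_singular)
    show "(\<lambda>c. c) \<in> hom (grp (singular_cx \<Delta> d (subspace X A)) n) (grp (singular_cx \<Delta> d X) n)" for n
      by (simp add: singular_cx_def hom_def Pi_iff order_trans[OF _ sub])
  qed (simp add: singular_cx_def)
  then show ?thesis
    unfolding singular_LES_def by (rule chain_map.long_exact_sequence) simp
qed

end

section \<open>Singular cubes\<close>

definition insert_at :: "nat \<Rightarrow> 'a \<Rightarrow> 'a list \<Rightarrow> 'a list" where
  "insert_at i e ts = take i ts @ e # drop i ts"

lemma length_insert_at [simp]: "length (insert_at i e ts) = Suc (length ts)"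
  by (simp add: insert_at_def)

lemma set_insert_at [simp]: "set (insert_at i e ts) = insert e (set ts)"
proof -
  have "set ts = set (take i ts) \<union> set (drop i ts)"
    by (metis append_take_drop_id set_append)
  then show ?thesis
    by (auto simp: insert_at_def)
qed

text \<open>The cubical counterpart of the cosimplicial identity, in the index pattern that
  \<open>alternating_double_sum\<close> expects.\<close>

lemma insert_at_commute:
  assumes "j < i" "i \<le> Suc (length ts)"
  shows "insert_at i a (insert_at j b ts) = insert_at j b (insert_at (i - 1) a ts)"
proof -
  obtain k where "i = Suc k" "j \<le> k" "k \<le> length ts"
    using assms by (cases i) auto
  then show ?thesis
    by (simp add: insert_at_def Suc_diff_le drop_take min_def)
qed

text \<open>This and the next two lemmas tell how coordinate \<open>k\<close> of the large cube
  appears on the face at \<open>i\<close>: as coordinate \<open>k\<close>, as the inserted entry, or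
  as coordinate \<open>k - 1\<close>.\<close>

lemma insert_at_update_less:
  "\<lbrakk>k < i; i \<le> length ts\<rbrakk> \<Longrightarrow> (insert_at i e ts)[k := t] = insert_at i e (ts[k := t])"
  by (simp add: insert_at_def list_update_append take_update_swap)

lemma insert_at_update_eq: "i \<le> length ts \<Longrightarrow> (insert_at i e ts)[i := t] = insert_at i t ts"
  by (simp add: insert_at_def list_update_append)

lemma insert_at_update_greater:
  assumes "i < k" "i \<le> length ts"
  shows "(insert_at i e ts)[k := t] = insert_at i e (ts[k - 1 := t])"
proof -
  obtain m where "k = Suc m" "i \<le> m"
    using assms by (cases k) auto
  then show ?thesis
    using assms by (simp add: insert_at_def list_update_append Suc_diff_le drop_update_swap min_def)
qed

text \<open>Chains supported on \<open>R\<close> form a subgroup, and each arises from basis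
  elements by differences. Degenerate chains can thus be recognised by their support.\<close>

lemma generate_frag_of:
  assumes "R \<subseteq> S"
  shows "generate (free_Abelian_group S) (frag_of ` R) = carrier (free_Abelian_group R)"
proof
  have R: "frag_of ` R \<subseteq> carrier (free_Abelian_group S)"
    using assms by auto
  have "subgroup (carrier (free_Abelian_group R)) (free_Abelian_group S)"
  proof (rule group.subgroupI[OF group_free_Abelian_group])
    show "carrier (free_Abelian_group R) \<subseteq> carrier (free_Abelian_group S)"
      using assms by auto
    show "carrier (free_Abelian_group R) \<noteq> {}"
      using keys_zero by force
  next
    fix a b assume "a \<in> carrier (free_Abelian_group R)" "b \<in> carrier (free_Abelian_group R)"
    then have ab: "Poly_Mapping.keys a \<subseteq> R" "Poly_Mapping.keys b \<subseteq> R"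
      by simp_all
    then show "inv\<^bsub>free_Abelian_group S\<^esub> a \<in> carrier (free_Abelian_group R)"
      using assms by (simp add: order_trans[OF _ assms])
    show "a \<otimes>\<^bsub>free_Abelian_group S\<^esub> b \<in> carrier (free_Abelian_group R)"
      using ab keys_add[of a b] by simp blast
  qed
  then show "generate (free_Abelian_group S) (frag_of ` R) \<subseteq> carrier (free_Abelian_group R)"
    by (intro group.generate_subgroup_incl[OF group_free_Abelian_group]) auto
  let ?G = "generate (free_Abelian_group S) (frag_of ` R)"
  have sub: "subgroup ?G (free_Abelian_group S)"
    by (rule group.generate_is_subgroup[OF group_free_Abelian_group R])
  show "carrier (free_Abelian_group R) \<subseteq> ?G"
  proof
    fix c assume "c \<in> carrier (free_Abelian_group R)"
    then have "Poly_Mapping.keys c \<subseteq> R"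
      by simp
    then show "c \<in> ?G"
    proof (induction c rule: frag_induction)
      case zero
      then show ?case using subgroup.one_closed[OF sub] by simp
    next
      case (one x)
      then show ?case by (auto intro: generate.incl)
    next
      case (diff a b)
      then have "Poly_Mapping.keys b \<subseteq> S"
        using subgroup.mem_carrier[OF sub] by auto
      then show ?case
        using subgroup.m_closed[OF sub diff.IH(1) subgroup.m_inv_closed[OF sub diff.IH(2)]] by simp
    qed
  qed
qed

section \<open>Cubical chains over an abstract model of the cubes\<close>

declare cube.simps(2) [simp del]

text \<open>This interface separates topology from algebra: the six choices of interval and product
  share one computation with lists. The endpoints are the values that faces insert.\<close>

locale cube_model =
  fixes T :: cube_product and J :: "real cspace"
  assumes closure_space_cube: "closure_space (cube T J n)"
    and points_cube: "points (cube T J n) = {ts. length ts = n \<and> set ts \<subseteq> points J}"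
    and ccontinuous_insert_at:
      "\<lbrakk>e \<in> points J; i \<le> n\<rbrakk> \<Longrightarrow> ccontinuous (cube T J n) (cube T J (Suc n)) (insert_at i e)"
    and endpoints: "0 \<in> points J" "1 \<in> points J"
begin

abbreviation face :: "nat \<Rightarrow> real \<Rightarrow> nat \<Rightarrow> (real list \<Rightarrow> 'a) \<Rightarrow> real list \<Rightarrow> 'a" where
  "face n e i \<sigma> \<equiv> restrict (\<sigma> \<circ> insert_at i e) (points (cube T J n))"

abbreviation cube_bd :: "nat \<Rightarrow> (real list \<Rightarrow> 'a) \<Rightarrow> (real list \<Rightarrow> 'a) \<Rightarrow>\<^sub>0 int" where
  "cube_bd n \<sigma> \<equiv> \<Sum>i=1..n. frag_cmul ((-1) ^ i)
     (frag_of (cube_face T J n 0 i \<sigma>) - frag_of (cube_face T J n 1 i \<sigma>))"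

text \<open>Passing from coordinates 1 to \<open>n + 1\<close> to positions 0 to \<open>n\<close>
  shifts every sign exponent by one.\<close>

lemma cube_bd_Suc:
  "cube_bd (Suc n) \<sigma> = (\<Sum>i\<le>n. frag_cmul ((-1) ^ Suc i) (frag_of (face n 0 i \<sigma>) - frag_of (face n 1 i \<sigma>)))"
  unfolding One_nat_def sum.atLeast1_atMost_eq lessThan_Suc_atMost
  by (simp add: cube_face_def insert_at_def o_def)

lemma keys_cube_bd:
  assumes "\<And>i. i \<le> n \<Longrightarrow> face n 0 i \<sigma> = face n 1 i \<sigma> \<or> face n 0 i \<sigma> \<in> S \<and> face n 1 i \<sigma> \<in> S"
  shows "Poly_Mapping.keys (cube_bd (Suc n) \<sigma>) \<subseteq> S"
proof -
  have "Poly_Mapping.keys (frag_cmul ((-1) ^ Suc i) (frag_of (face n 0 i \<sigma>) - frag_of (face n 1 i \<sigma>))) \<subseteq> S"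
    if "i \<le> n" for i
  proof (cases "face n 0 i \<sigma> = face n 1 i \<sigma>")
    case False
    then have "face n 0 i \<sigma> \<in> S" "face n 1 i \<sigma> \<in> S"
      using assms[OF that] by blast+
    moreover have "Poly_Mapping.keys (frag_of (face n 0 i \<sigma>) - frag_of (face n 1 i \<sigma>))
        \<subseteq> {face n 0 i \<sigma>, face n 1 i \<sigma>}"
      using keys_diff[of "frag_of (face n 0 i \<sigma>)" "frag_of (face n 1 i \<sigma>)"] by auto
    ultimately show ?thesis
      using keys_cmul by blast
  qed simp
  then show ?thesis
    unfolding cube_bd_Suc by (intro order_trans[OF keys_sum] UN_least) auto
qed

lemma face_cube:
  assumes "\<sigma> \<in> singular_cubes T J (Suc n) X" "i \<le> n" "e \<in> points J"
  shows "face n e i \<sigma> \<in> singular_cubes T J n X"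
  using assms ccontinuous_compose[OF ccontinuous_insert_at[OF assms(3,2)]]
  by (auto simp: singular_cubes_def ccontinuous_restrict closure_space_cube)

lemma face_face_cube:
  assumes "j < i" "i \<le> Suc n" "e \<in> points J" "e' \<in> points J"
  shows "face n e j (face (Suc n) e' i \<sigma>) = face n e' (i - 1) (face (Suc n) e j \<sigma>)"
  using assms by (auto simp: points_cube insert_at_commute intro!: restrict_ext)

lemma degenerate_cubes_iff:
  "\<sigma> \<in> degenerate_cubes T J n X \<longleftrightarrow> \<sigma> \<in> singular_cubes T J n X \<and>
     (\<exists>k<n. \<forall>ts\<in>points (cube T J n). \<forall>t\<in>points J. \<sigma> (ts[k := t]) = \<sigma> ts)"
proof -
  have "{1..n} = Suc ` {..<n}"
    by (simp add: image_Suc_lessThan)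
  then show ?thesis
    unfolding degenerate_cubes_def by auto
qed

text \<open>Let \<open>\<sigma>\<close> be independent of position \<open>k\<close>. Fixing that
  very position at 0 or at 1 gives the same cube; fixing another one leaves a cube still independent
  of the place to which \<open>k\<close> has moved.\<close>

lemma face_degenerate:
  assumes \<sigma>: "\<sigma> \<in> degenerate_cubes T J (Suc n) X" and i: "i \<le> n"
  shows "face n 0 i \<sigma> = face n 1 i \<sigma> \<or>
    face n 0 i \<sigma> \<in> degenerate_cubes T J n X \<and> face n 1 i \<sigma> \<in> degenerate_cubes T J n X"
proof -
  obtain k where k: "k \<le> n" and \<sigma>k: "\<And>ts t. \<lbrakk>ts \<in> points (cube T J (Suc n)); t \<in> points J\<rbrakk> \<Longrightarrow> \<sigma> (ts[k := t]) = \<sigma> ts"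
    using \<sigma> by (auto simp: degenerate_cubes_iff less_Suc_eq_le)
  have ins: "insert_at i e ts \<in> points (cube T J (Suc n))" if "ts \<in> points (cube T J n)" "e \<in> points J" for e ts
    using that by (auto simp: points_cube)
  have upd: "ts[l := t] \<in> points (cube T J n)" if "ts \<in> points (cube T J n)" "t \<in> points J" for ts l t
    using that set_update_subset_insert[of ts l t] by (auto simp: points_cube)
  have deg: "face n e i \<sigma> \<in> degenerate_cubes T J n X" if "i \<noteq> k" "e \<in> points J" for e
  proof -
    \<comment> \<open>The place of coordinate \<open>k\<close> once position \<open>i\<close> has
      been removed.\<close>
    define l where "l = (if k < i then k else k - 1)"
    have "insert_at i e (ts[l := t]) = (insert_at i e ts)[k := t]" if "ts \<in> points (cube T J n)" for ts t
      using that i \<open>i \<noteq> k\<close>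
      by (auto simp: l_def points_cube insert_at_update_less insert_at_update_greater)
    then have "\<forall>ts\<in>points (cube T J n). \<forall>t\<in>points J. face n e i \<sigma> (ts[l := t]) = face n e i \<sigma> ts"
      using upd \<sigma>k[OF ins[OF _ \<open>e \<in> points J\<close>]] by simp
    moreover have "l < n"
      using k i \<open>i \<noteq> k\<close> by (auto simp: l_def)
    ultimately show ?thesis
      using face_cube[OF _ i \<open>e \<in> points J\<close>] \<sigma> unfolding degenerate_cubes_iff by blast
  qed
  have "face n 0 i \<sigma> = face n 1 i \<sigma>" if "i = k"
  proof (rule restrict_ext)
    fix ts assume ts: "ts \<in> points (cube T J n)"
    then have "i \<le> length ts"
      using i by (simp add: points_cube)
    then show "(\<sigma> \<circ> insert_at i 0) ts = (\<sigma> \<circ> insert_at i 1) ts"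
      using \<sigma>k[OF ins[OF ts endpoints(1)] endpoints(2)] that by (simp add: insert_at_update_eq)
  qed
  then show ?thesis
    using deg endpoints by blast
qed

lemma grp_all_cubes:
  "grp (all_cubes_cx T J X) n = free_Abelian_group (if n < 0 then {} else singular_cubes T J (nat n) X)"
  by (simp add: all_cubes_cx_def)

lemma bd_all_cubes:
  "bd (all_cubes_cx T J X) n = (if n \<le> 0 then (\<lambda>_. 0) else frag_extend (cube_bd (nat n)))"
  by (simp add: all_cubes_cx_def)

lemma chain_complex_all_cubes: "chain_complex (all_cubes_cx T J X)"
proof (rule chain_complex_free[OF grp_all_cubes bd_all_cubes])
  show "Poly_Mapping.keys (cube_bd (Suc n) \<sigma>) \<subseteq> singular_cubes T J n X"
    if "\<sigma> \<in> singular_cubes T J (Suc n) X" for n \<sigma>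
    using face_cube[OF that] endpoints by (intro keys_cube_bd) blast
  show "frag_extend (cube_bd (Suc n)) (cube_bd (Suc (Suc n)) \<sigma>) = 0" for n and \<sigma> :: "real list \<Rightarrow> 'a"
  proof -
    \<comment> \<open>The four double faces with their endpoint signs. Commuting two faces also
      exchanges the endpoints, so the mixed terms, both negative, trade places and the total is
      unchanged.\<close>
    define g where "g i j =
      (frag_of (face n 0 j (face (Suc n) 0 i \<sigma>)) - frag_of (face n 1 j (face (Suc n) 0 i \<sigma>))) -
      (frag_of (face n 0 j (face (Suc n) 1 i \<sigma>)) - frag_of (face n 1 j (face (Suc n) 1 i \<sigma>)))" for i j
    have cmul_diff: "frag_cmul c (x - y) = frag_cmul c x - frag_cmul c y" for c and x y :: "(real list \<Rightarrow> 'a) \<Rightarrow>\<^sub>0 int"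
      by (rule poly_mapping_eqI) (simp add: lookup_minus right_diff_distrib)
    \<comment> \<open>The two shifted exponents \<open>Suc i\<close> and \<open>Suc j\<close>
      together give the sign of \<open>i + j\<close>.\<close>
    have "frag_extend (cube_bd (Suc n)) (cube_bd (Suc (Suc n)) \<sigma>) =
      (\<Sum>i\<le>Suc n. \<Sum>j\<le>n. frag_cmul ((-1) ^ (i + j)) (g i j))"
      unfolding g_def cube_bd_Suc
      by (simp add: frag_extend_sum o_def frag_extend_cmul frag_extend_diff frag_cmul_sum
          cmul_diff power_add sum_subtractf del: sum.atMost_Suc restrict_apply)
    also have "\<dots> = 0"
    proof (rule alternating_double_sum)
      fix i j assume "j < i" "i \<le> Suc n"
      note f = face_face_cube[OF this]
      show "g i j = g j (i - 1)"
        unfolding g_def f[OF endpoints(1,1)] f[OF endpoints(1,2)] f[OF endpoints(2,1)] f[OF endpoints(2,2)]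
        by simp
    qed
    finally show ?thesis .
  qed
qed

text \<open>Closure under the boundary and the comparison of \<open>A\<close> with \<open>X\<close>
  are both carried out on this support condition.\<close>

lemma degenerate_chains_iff:
  "c \<in> degenerate_chains T J X n \<longleftrightarrow>
     Poly_Mapping.keys c \<subseteq> (if n < 0 then {} else degenerate_cubes T J (nat n) X)"
proof -
  have "(if n < 0 then {} else degenerate_cubes T J (nat n) X) \<subseteq> (if n < 0 then {} else singular_cubes T J (nat n) X)"
    by (auto simp: degenerate_cubes_def)
  from generate_frag_of[OF this] show ?thesis
    unfolding degenerate_chains_def grp_all_cubes by simp
qed

lemma subcomplex_degenerate: "subcomplex (all_cubes_cx T J X) (degenerate_chains T J X)"
proof (intro subcomplex.intro subcomplex_axioms.intro chain_complex_all_cubes)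
  fix n
  show "subgroup (degenerate_chains T J X n) (grp (all_cubes_cx T J X) n)"
    unfolding degenerate_chains_def grp_all_cubes
    by (rule group.generate_is_subgroup[OF group_free_Abelian_group]) (auto simp: degenerate_cubes_def)
  fix c assume c: "c \<in> degenerate_chains T J X n"
  show "bd (all_cubes_cx T J X) n c \<in> degenerate_chains T J X (n - 1)"
  proof (cases "n \<le> 0")
    case False
    then obtain m where m: "nat n = Suc m" "nat (n - 1) = m"
      by (cases "nat n") auto
    have "Poly_Mapping.keys (cube_bd (Suc m) \<sigma>) \<subseteq> degenerate_cubes T J m X"
      if "\<sigma> \<in> Poly_Mapping.keys c" for \<sigma>
    proof (rule keys_cube_bd)
      have "\<sigma> \<in> degenerate_cubes T J (Suc m) X"
        using c that False m by (auto simp: degenerate_chains_iff)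
      then show "face m 0 i \<sigma> = face m 1 i \<sigma> \<or>
          face m 0 i \<sigma> \<in> degenerate_cubes T J m X \<and> face m 1 i \<sigma> \<in> degenerate_cubes T J m X"
        if "i \<le> m" for i
        using that by (rule face_degenerate)
    qed
    then have "Poly_Mapping.keys (frag_extend (cube_bd (Suc m)) c) \<subseteq> degenerate_cubes T J m X"
      by (intro order_trans[OF keys_frag_extend] UN_least)
    then show ?thesis
      using False m by (simp add: degenerate_chains_iff bd_all_cubes)
  qed (simp add: degenerate_chains_iff bd_all_cubes)
qed

lemma cubical_LES:
  assumes "A \<subseteq> points X"
  shows "cubical_LES T J X A"
proof -
  let ?QA = "all_cubes_cx T J (subspace X A)" and ?QX = "all_cubes_cx T J X"
  let ?DA = "degenerate_chains T J (subspace X A)" and ?DX = "degenerate_chains T J X"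
  have sub: "singular_cubes T J n (subspace X A) \<subseteq> singular_cubes T J n X" for n
    using ccontinuous_subspace[OF assms] by (auto simp: singular_cubes_def)
  have incl: "chain_map ?QA ?QX (\<lambda>n c. c)"
  proof (intro chain_map.intro chain_map_axioms.intro chain_complex_all_cubes)
    show "(\<lambda>c. c) \<in> hom (grp ?QA n) (grp ?QX n)" for n
      by (simp add: grp_all_cubes hom_def Pi_iff order_trans[OF _ sub])
  qed (simp add: bd_all_cubes)
  have deg: "degenerate_cubes T J n (subspace X A) =
      degenerate_cubes T J n X \<inter> singular_cubes T J n (subspace X A)" for n
    using sub[of n] by (auto simp: degenerate_cubes_iff)
  have iff: "c \<in> ?DX n \<longleftrightarrow> c \<in> ?DA n" if "c \<in> carrier (grp ?QA n)" for n c
    using that by (auto simp: degenerate_chains_iff grp_all_cubes deg split: if_splits)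
  interpret DA: subcomplex ?QA ?DA by (rule subcomplex_degenerate)
  interpret DX: subcomplex ?QX ?DX by (rule subcomplex_degenerate)
  interpret incl: chain_map ?QA ?QX "\<lambda>n c. c" by (rule incl)
  have "chain_map (cubical_cx T J (subspace X A)) (cubical_cx T J X) (cubical_inclusion T J X)"
    unfolding cubical_cx_def cubical_inclusion_def
    by (rule quot_map_chain_map[OF DA.subcomplex_axioms DX.subcomplex_axioms incl])
      (metis iff DA.sub subgroup.mem_carrier)
  moreover have "inj_on (cubical_inclusion T J X n) (carrier (grp (cubical_cx T J (subspace X A)) n))" for n
    unfolding cubical_cx_def cubical_inclusion_def DA.grp_quotient
    by (rule inj_quot_map[OF incl.F.group_hom_axioms DA.sub DX.sub iff])
  ultimately show ?thesis
    unfolding cubical_LES_def by (rule chain_map.long_exact_sequence)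
qed

end

section \<open>Cubes of the two products as models\<close>

lemma closure_space_cube:
  assumes T: "\<And>Y. closure_space Y \<Longrightarrow> closure_space (T J Y)"
  shows "closure_space (cube T J n)"
  by (induction n) (auto simp: cube.simps(2) closure_space_indiscrete intro: closure_space_relabel T)

lemma points_cube:
  assumes "\<And>Y. points (T J Y) = points J \<times> points Y"
  shows "points (cube T J n) = {ts. length ts = n \<and> set ts \<subseteq> points J}"
proof (induction n)
  case 0
  then show ?case by (auto simp: indiscrete_def)
next
  case (Suc n)
  have "(\<lambda>(t, ts). t # ts) ` (points J \<times> {ts. length ts = n \<and> set ts \<subseteq> points J}) =
      {ts. length ts = Suc n \<and> set ts \<subseteq> points J}"
    by (force simp: length_Suc_conv image_iff)
  then show ?case
    using Suc by (simp add: cube.simps(2) assms)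
qed

text \<open>Insertion at position 0 is a slice followed by consing. Insertion at
  \<open>Suc k\<close> leaves the leading coordinate alone and inserts at \<open>k\<close> in the
  tail, so it is \<open>map_snd\<close> applied to the induction hypothesis.\<close>

lemma cube_model_intro:
  assumes J: "closure_space J" "0 \<in> points J" "1 \<in> points J"
    and points: "\<And>Y. points (T J Y) = points J \<times> points Y"
    and closure: "\<And>Y. closure_space Y \<Longrightarrow> closure_space (T J Y)"
    and slice: "\<And>x Y. \<lbrakk>closure_space Y; x \<in> points J\<rbrakk> \<Longrightarrow> ccontinuous Y (T J Y) (Pair x)"
    and map_snd: "\<And>Y Z f. \<lbrakk>closure_space Y; closure_space Z; ccontinuous Y Z f\<rbrakk>
      \<Longrightarrow> ccontinuous (T J Y) (T J Z) (\<lambda>(x, y). (x, f y))"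
  shows "cube_model T J"
proof (rule cube_model.intro)
  show cl: "closure_space (cube T J n)" for n
    by (rule closure_space_cube) (rule closure)
  let ?c = "\<lambda>(t :: real, ts). t # ts"
  have cons: "ccontinuous (T J (cube T J n)) (cube T J (Suc n)) ?c" for n
    unfolding cube.simps(2) by (intro ccontinuous_relabel closure cl)
  show "ccontinuous (cube T J n) (cube T J (Suc n)) (insert_at i e)" if "e \<in> points J" "i \<le> n" for e i n
    using \<open>i \<le> n\<close>
  proof (induction n arbitrary: i)
    case 0
    have "?c \<circ> Pair e = insert_at 0 e"
      by (auto simp: insert_at_def)
    then show ?case
      using 0 ccontinuous_compose[OF slice[OF cl \<open>e \<in> points J\<close>] cons, of 0] by simp
  next
    case (Suc n)
    show ?case
    proof (cases i)
      case 0
      have "?c \<circ> Pair e = insert_at 0 e"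
        by (auto simp: insert_at_def)
      then show ?thesis
        unfolding 0 using ccontinuous_compose[OF slice[OF cl \<open>e \<in> points J\<close>] cons, of "Suc n"] by simp
    next
      case (Suc k)
      let ?m = "\<lambda>(t, ts). (t, insert_at k e ts)"
      have "ccontinuous (T J (cube T J n)) (T J (cube T J (Suc n))) ?m"
        using Suc Suc.prems by (intro map_snd cl Suc.IH) simp
      from ccontinuous_compose[OF this cons]
      have "ccontinuous (T J (cube T J n)) (cube T J (Suc (Suc n))) (?c \<circ> ?m)" .
      \<comment> \<open>Consing intertwines insertion in the tail with insertion in the whole list;
        continuity then descends along the relabelling that defines the source cube.\<close>
      moreover have "?c \<circ> ?m = insert_at i e \<circ> ?c"
        by (auto simp: insert_at_def Suc)
      ultimately show ?thesis
        unfolding cube.simps(2)[of T J n] by (intro ccontinuous_from_relabel cl) simp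
    qed
  qed
qed (simp_all add: points_cube points J)

lemma cube_model_box_product:
  fixes box :: "real \<Rightarrow> real list \<Rightarrow> _"
  assumes "basic_box box" "closure_space J" "0 \<in> points J" "1 \<in> points J"
  shows "cube_model (basic_box.box_product box) J"
proof -
  interpret basic_box box by fact
  show ?thesis
    by (intro cube_model_intro points_box_product closure_space_box_product ccontinuous_slice
        ccontinuous_map_snd assms(2-4))
qed

section \<open>The three families of simplices\<close>

lemma cosimplicial_I: "cosimplicial_cspace simplex_I simplical_face"
proof
  show "closure_space (simplex_I n)" for n
    unfolding simplex_I_def by (rule closure_space_topology)
  have points: "points (simplex_I n) = standard_simplex n" for n
    by (simp add: simplex_I_def cspace_of_topology_def topspace_standard_simplex)
  show "ccontinuous (simplex_I n) (simplex_I (Suc n)) (simplical_face i)" if "i \<le> Suc n" for i n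
    unfolding simplex_I_def
  proof (rule ccontinuous_topology)
    let ?PT = "powertop_real (UNIV :: nat set)"
    have "simplical_face i \<in> standard_simplex n \<rightarrow> standard_simplex (Suc n)"
      using simplical_face_in_standard_simplex[of "Suc n" i] that by auto
    \<comment> \<open>Each coordinate of the face is a coordinate of \<open>x\<close> or the
      constant 0.\<close>
    moreover have "continuous_map ?PT euclideanreal (\<lambda>x. simplical_face i x k)" for k
      by (auto simp: simplical_face_def intro: continuous_map_product_projection)
    ultimately show "continuous_map (subtopology ?PT (standard_simplex n))
        (subtopology ?PT (standard_simplex (Suc n))) (simplical_face i)"
      by (simp add: continuous_map_in_subtopology continuous_map_componentwise_UNIV
          continuous_map_from_subtopology topspace_standard_simplex image_subset_iff_funcset)
  qed
  show "simplical_face i (simplical_face j x) = simplical_face j (simplical_face (i - 1) x)"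
    if "j < i" "i \<le> Suc (Suc n)" "x \<in> points (simplex_I n)" for i j n x
    using that(1) by (auto simp: simplical_face_def fun_eq_iff)
qed

lemma vertex_face_vertex_face: "j < i \<Longrightarrow> vertex_face i (vertex_face j k) = vertex_face j (vertex_face (i - 1) k)"
  by (auto simp: vertex_face_def)

lemma vertex_face_le: "k \<le> n \<Longrightarrow> vertex_face i k \<le> Suc n"
  by (simp add: vertex_face_def)

lemma cosimplicial_J1: "cosimplicial_cspace simplex_J1 vertex_face"
proof
  show "closure_space (simplex_J1 n)" for n
    unfolding simplex_J1_def by (rule closure_space_indiscrete)
  show "ccontinuous (simplex_J1 n) (simplex_J1 (Suc n)) (vertex_face i)" for i n
    by (auto simp: ccontinuous_def simplex_J1_def indiscrete_def vertex_face_le)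
qed (rule vertex_face_vertex_face)

lemma cosimplicial_Jplus: "cosimplicial_cspace simplex_Jplus vertex_face"
proof
  show "closure_space (simplex_Jplus n)" for n
    unfolding simplex_Jplus_def by (rule closure_space_upward)
  \<comment> \<open>Monotone maps are continuous for the upward closures.\<close>
  have "vertex_face i k \<le> vertex_face i l" if "k \<le> l" for i k l
    using that by (auto simp: vertex_face_def)
  then show "ccontinuous (simplex_Jplus n) (simplex_Jplus (Suc n)) (vertex_face i)" for i n
    by (auto simp: ccontinuous_def simplex_Jplus_def upward_def vertex_face_le)
qed (rule vertex_face_vertex_face)

theorem theorem5p15:
  fixes X :: "'a cspace" and A :: "'a set"
  assumes "closure_space X" and "A \<subseteq> points X"
  shows "singular_LES simplex_I simplical_face X A
       \<and> singular_LES simplex_J1 vertex_face X A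
       \<and> singular_LES simplex_Jplus vertex_face X A
       \<and> (\<forall>J \<in> {interval_I, interval_J1, interval_Jplus}.
            \<forall>T \<in> {cproduct, inductive_product}. cubical_LES T J X A)"
proof -
  have J: "closure_space J" "0 \<in> points J" "1 \<in> points J"
    if "J \<in> {interval_I, interval_J1, interval_Jplus}" for J
  proof -
    show "closure_space J"
      using that closure_space_topology closure_space_indiscrete closure_space_upward
      by (auto simp: interval_I_def interval_J1_def interval_Jplus_def)
    show "0 \<in> points J" "1 \<in> points J"
      using that by (auto simp: interval_I_def interval_J1_def interval_Jplus_def
          cspace_of_topology_def indiscrete_def upward_def)
  qed
  have "cubical_LES T J X A"
    if "J \<in> {interval_I, interval_J1, interval_Jplus}" "T \<in> {cproduct, inductive_product}" for J T
  proof -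
    \<comment> \<open>Rectangles account for \<open>cproduct\<close>, crosses for
      \<open>inductive_product\<close>.\<close>
    have "cube_model T J"
      using that(2) J[OF that(1)] cube_model_box_product[OF basic_box_Times]
        cube_model_box_product[OF basic_box_cross]
      unfolding box_product_Times box_product_cross by auto
    then show ?thesis
      by (rule cube_model.cubical_LES[OF _ assms(2)])
  qed
  then show ?thesis
    using cosimplicial_I cosimplicial_J1 cosimplicial_Jplus
    by (simp add: cosimplicial_cspace.singular_LES[OF _ assms(2)])
qed

end
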